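(* Let $n\ge 3$ be an integer and let $H_n$ be the Hessian matrix of the quadratic form $\psi$ in $n$ variables, with eigenvalues counted with multiplicity. (1) If $n\ge 8$ and $H_n$ has at least two strictly positive and at least two strictly negative eigenvalues, then $\mathrm{GST}_n$ is connected. (2) If $H_n$ has only one strictly positive eigenvalue or only one strictly negative eigenvalue, then $\mathrm{GST}_n$ is disconnected.
   Context: For $n\ge 2$ and $\mathbf p=(p_1,\dots,p_n)\in\mathbb R^n$ let $$\psi(\mathbf p)=\bigg(\frac{1}{2^{n-1}}\sum_{k=0}^{n-1}\binom{n-1}{k}p_{k+1}\bigg)^2-\frac{1}{2^{n-1}}\sum_{k=0}^{n-2}\binom{n-2}{k}\big(p_{k+2}^2+p_{k+1}p_{n-(k+1)}\big),$$ and let $H_n=\big(\partial^2\psi/\partial p_i\partial p_j\big)_{1\le i,j\le n}$, a constant real symmetric matrix (so $\psi(\mathbf p)=\frac12\mathbf p^TH_n\mathbf p$). Put $\mathrm{Ind}_n=\{\mathbf p\in[0,1]^n:\psi(\mathbf p)=0\}$. For $x\in\{0,1\}^n$ and $1\le i\le n$ put $\pi_i(x)=p_k$ with $k=\#\{j: x_j=x_i\}$. $\mathrm{Inf}_n$ is the set of $\mathbf p\in[0,1]^n$ such that for all $1\le i,j\le n$ there is $x\in\{0,1\}^n$ with $\pi_i(x)\neq\pi_i(x')$, where $x'$ is $x$ with its $j$-th coordinate flipped. $\mathrm{GST}_n=\mathrm{Ind}_n\cap\mathrm{Inf}_n$, with the subspace topology from $\mathbb R^n$. *)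

theory Defs
  imports
    "HOL-Analysis.Analysis"
    "Jordan_Normal_Form.Char_Poly"
begin

text \<open>
  A point of \<open>\<real>\<^sup>n\<close> is a function \<open>p :: nat \<Rightarrow> real\<close> read at the indices \<open>1, \<dots>, n\<close>.  As
  carrier of \<open>\<real>\<^sup>n\<close> we take the functions that are \<^const>\<open>extensional\<close> on \<open>{1..n}\<close>; its
  topology is \<open>powertop_real {1..n}\<close>.
\<close>

definition psi :: "nat \<Rightarrow> (nat \<Rightarrow> real) \<Rightarrow> real" where
  "psi n p =
     (1 / 2 ^ (n - 1) * (\<Sum>k = 0..n - 1. real ((n - 1) choose k) * p (k + 1))) ^ 2
     - 1 / 2 ^ (n - 1) *
       (\<Sum>k = 0..n - 2. real ((n - 2) choose k) *
          ((p (k + 2)) ^ 2 + p (k + 1) * p (n - (k + 1))))"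

definition partial_deriv :: "nat \<Rightarrow> ((nat \<Rightarrow> real) \<Rightarrow> real) \<Rightarrow> (nat \<Rightarrow> real) \<Rightarrow> real" where
  "partial_deriv i f p = deriv (\<lambda>t. f (p(i := t))) (p i)"

text \<open>Matrix indices start at 0, so entry \<open>(i, j)\<close> belongs to the variables \<open>i + 1\<close>, \<open>j + 1\<close>.\<close>

definition hessian :: "nat \<Rightarrow> ((nat \<Rightarrow> real) \<Rightarrow> real) \<Rightarrow> (nat \<Rightarrow> real) \<Rightarrow> real mat" where
  "hessian n f p =
     Matrix.mat n n (\<lambda>(i, j). partial_deriv (i + 1) (partial_deriv (j + 1) f) p)"

text \<open>
  The Hessian of \<^term>\<open>psi n\<close> does not depend on the point (\<open>hessian_psi\<close> below), so it is
  taken at the origin.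
\<close>

definition Hess :: "nat \<Rightarrow> real mat" where
  "Hess n = hessian n (psi n) (\<lambda>_. 0)"

definition dpsi :: "nat \<Rightarrow> nat \<Rightarrow> (nat \<Rightarrow> real) \<Rightarrow> real" where
  "dpsi n j p =
     2 * (1 / 2 ^ (n - 1) * (\<Sum>k = 0..n - 1. real ((n - 1) choose k) * p (k + 1)))
       * (1 / 2 ^ (n - 1) * (\<Sum>k = 0..n - 1. real ((n - 1) choose k) * of_bool (k + 1 = j)))
     - 1 / 2 ^ (n - 1) *
       (\<Sum>k = 0..n - 2. real ((n - 2) choose k) *
          (2 * p (k + 2) * of_bool (k + 2 = j)
           + (of_bool (k + 1 = j) * p (n - (k + 1)) + p (k + 1) * of_bool (n - (k + 1) = j))))"

definition ddpsi :: "nat \<Rightarrow> nat \<Rightarrow> nat \<Rightarrow> real" where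
  "ddpsi n i j =
     2 * (1 / 2 ^ (n - 1) * (\<Sum>k = 0..n - 1. real ((n - 1) choose k) * of_bool (k + 1 = i)))
       * (1 / 2 ^ (n - 1) * (\<Sum>k = 0..n - 1. real ((n - 1) choose k) * of_bool (k + 1 = j)))
     - 1 / 2 ^ (n - 1) *
       (\<Sum>k = 0..n - 2. real ((n - 2) choose k) *
          (2 * of_bool (k + 2 = i) * of_bool (k + 2 = j)
           + (of_bool (k + 1 = j) * of_bool (n - (k + 1) = i) + of_bool (k + 1 = i) * of_bool (n - (k + 1) = j))))"

lemma coord_deriv:
  "((\<lambda>t. (p(i := t)) k) has_real_derivative of_bool (k = i)) (at x)"
  by (cases "k = i") auto

lemma partial_deriv_psi: "partial_deriv j (psi n) = dpsi n j"
proof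
  fix p :: "nat \<Rightarrow> real"
  have "((\<lambda>t. psi n (p(j := t))) has_real_derivative dpsi n j p) (at (p j))"
    unfolding psi_def dpsi_def
    by (rule derivative_eq_intros coord_deriv refl)+
       (simp_all add: fun_upd_triv mult_ac del: fun_upd_apply)
  then show "partial_deriv j (psi n) p = dpsi n j p"
    unfolding partial_deriv_def by (rule DERIV_imp_deriv)
qed

lemma partial_deriv_dpsi: "partial_deriv i (dpsi n j) p = ddpsi n i j"
proof -
  have "((\<lambda>t. dpsi n j (p(i := t))) has_real_derivative ddpsi n i j) (at (p i))"
    unfolding dpsi_def ddpsi_def
    by (rule derivative_eq_intros coord_deriv refl)+
       (simp_all add: fun_upd_triv mult_ac del: fun_upd_apply)
  then show ?thesis
    unfolding partial_deriv_def by (rule DERIV_imp_deriv)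
qed

lemma hessian_psi: "hessian n (psi n) p = Hess n"
  by (simp add: Hess_def hessian_def partial_deriv_psi partial_deriv_dpsi)

text \<open>
  Eigenvalues with algebraic multiplicity.  The matrix \<^term>\<open>Hess n\<close> is real symmetric, so
  restricting to real roots of the characteristic polynomial loses none of them.
\<close>

definition eigenvalues_mset :: "real mat \<Rightarrow> real multiset" where
  "eigenvalues_mset A = proots (char_poly A)"

definition num_pos_eigenvalues :: "real mat \<Rightarrow> nat" where
  "num_pos_eigenvalues A = size {#a \<in># eigenvalues_mset A. a > 0#}"

definition num_neg_eigenvalues :: "real mat \<Rightarrow> nat" where
  "num_neg_eigenvalues A = size {#a \<in># eigenvalues_mset A. a < 0#}"

definition Ind :: "nat \<Rightarrow> (nat \<Rightarrow> real) set" where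
  "Ind n = {p \<in> {1..n} \<rightarrow>\<^sub>E {0..1}. psi n p = 0}"

definition pi_val :: "nat \<Rightarrow> (nat \<Rightarrow> real) \<Rightarrow> nat \<Rightarrow> (nat \<Rightarrow> nat) \<Rightarrow> real" where
  "pi_val n p i x = p (card {j \<in> {1..n}. x j = x i})"

text \<open>Flips the coordinate \<open>j\<close> of a vector with entries in \<open>{0, 1}\<close>.\<close>

definition flip :: "nat \<Rightarrow> (nat \<Rightarrow> nat) \<Rightarrow> nat \<Rightarrow> nat" where
  "flip j x = x(j := 1 - x j)"

definition Inf_set :: "nat \<Rightarrow> (nat \<Rightarrow> real) set" where
  "Inf_set n = {p \<in> {1..n} \<rightarrow>\<^sub>E {0..1}.
     \<forall>i \<in> {1..n}. \<forall>j \<in> {1..n}. \<exists>x \<in> {1..n} \<rightarrow>\<^sub>E {0, 1}.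
       pi_val n p i x \<noteq> pi_val n p i (flip j x)}"

definition GST :: "nat \<Rightarrow> (nat \<Rightarrow> real) set" where
  "GST n = Ind n \<inter> Inf_set n"

definition GST_space :: "nat \<Rightarrow> (nat \<Rightarrow> real) topology" where
  "GST_space n = subtopology (powertop_real {1..n}) (GST n)"

end

theory Submission
  imports Defs
begin

text \<open>
  A point of the cube is influential iff it is not a palindrome, and \<^term>\<open>psi n\<close> is
  invariant under adding constants.  Thus \<^term>\<open>GST n\<close> is, up to the radial direction from the
  centre of the cube, the zero cone of a quadratic form with the palindromes removed.  It is connected
  as soon as the cone contains a plane that meets the palindromes trivially, since every point of the
  cone is orthogonal to a vector of that plane.  For \<open>n \<ge> 8\<close> there is an explicit such plane.

  Part (2) concerns only \<open>n = 3\<close> and \<open>n = 4\<close>: for \<open>n \<ge> 5\<close> the form is positive definite on one plane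
  and negative definite on another, so by the spectral theorem there are two eigenvalues of each sign.
  For \<open>n = 3\<close> and \<open>n = 4\<close> a linear form without zeros on \<^term>\<open>GST n\<close> separates it.
\<close>

section \<open>Symmetric real matrices\<close>

text \<open>The complexified matrix has a characteristic root \<open>z\<close>. Symmetry lets the
  matrix pass from one side of the Hermitian product \<open>v \<bullet>c v\<close> to the other,
  which forces \<open>z = cnj z\<close>.\<close>

lemma symmetric_real_mat_eigenvector:
  fixes A :: "real mat"
  assumes A: "A \<in> carrier_mat n n" and sym: "transpose_mat A = A" and n: "n > 0"
  obtains v e where "eigenvector A v e"
proof -
  let ?c = "map_mat complex_of_real A"
  have C: "?c \<in> carrier_mat n n" using A by simp
  have "degree (char_poly ?c) \<noteq> 0" using degree_monic_char_poly[OF C] n by simp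
  then obtain z where z: "poly (char_poly ?c) z = 0"
    using fundamental_theorem_of_algebra constant_degree by metis
  then obtain v where v: "eigenvector ?c v z"
    using eigenvalue_root_char_poly[OF C] unfolding eigenvalue_def by blast
  have vc: "v \<in> carrier_vec n" and v0: "v \<noteq> 0\<^sub>v n" and ev: "?c *\<^sub>v v = z \<cdot>\<^sub>v v"
    using v C unfolding eigenvector_def by auto
  have wc: "conjugate v \<in> carrier_vec n" using vc by simp
  have symC: "transpose_mat ?c = ?c" using sym by (metis map_mat_transpose)
  have conj: "?c *\<^sub>v conjugate v = conjugate (?c *\<^sub>v v)"
    using A vc by (intro eq_vecI) (auto simp: scalar_prod_def)
  have "z * (v \<bullet>c v) = (?c *\<^sub>v v) \<bullet> conjugate v"
    using vc wc by (simp add: ev)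
  also have "\<dots> = v \<bullet> (?c *\<^sub>v conjugate v)"
    using transpose_vec_mult_scalar[OF C wc vc] symC by simp
  also have "\<dots> = cnj z * (v \<bullet>c v)"
    using vc by (simp add: conj ev conjugate_smult_vec)
  finally have "z = cnj z" using conjugate_square_eq_0_vec[OF vc] v0 by simp
  then obtain e where e: "z = complex_of_real e"
    by (metis Reals_cnj_iff Reals_cases)
  \<comment> \<open>The real number \<open>e\<close> is a root of the real characteristic
    polynomial, so it has a real eigenvector; the complex \<open>v\<close> only served to show that
    \<open>z\<close> is real.\<close>
  have "poly (char_poly A) e = 0"
    using z unfolding e of_real_hom.char_poly_hom[OF A]
    by simp
  then show thesis
    using eigenvalue_root_char_poly[OF A] that unfolding eigenvalue_def by blast
qed

text \<open>The Householder reflection exchanging \<open>v\<close> and the first unit vector.\<close>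
lemma orthogonal_involution_to_unit_vec:
  fixes v :: "real vec"
  assumes v: "v \<in> carrier_vec n" and n: "n > 0" and norm: "v \<bullet> v = 1" and v0: "v $ 0 \<noteq> 1"
  obtains H where "H \<in> carrier_mat n n" "transpose_mat H = H" "H * H = 1\<^sub>m n" "H *\<^sub>v v = unit_vec n 0"
proof -
  \<comment> \<open>\<open>w\<close> is \<open>v\<close> minus the first unit vector. Since
    \<open>v\<close> has norm 1, the square norm of \<open>w\<close> is \<open>2 * c\<close>, so the
    usual factor \<open>2 / (w \<bullet> w)\<close> of the reflection along \<open>w\<close> becomes
    \<open>1 / c\<close>.\<close>
  define w where "w i = v $ i - of_bool (i = 0)" for i
  define c where "c = 1 - v $ 0"
  define H where "H = Matrix.mat n n (\<lambda>(i, j). of_bool (i = j) - w i * w j / c)"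
  have c: "c \<noteq> 0" using v0 by (simp add: c_def)
  have vv: "(\<Sum>k<n. v $ k * v $ k) = 1"
    using norm v by (simp add: scalar_prod_def atLeast0LessThan)
  have d0: "(\<Sum>k<n. of_bool (k = 0) * f k) = f 0" for f :: "nat \<Rightarrow> real"
    using n by (subst sum.remove[of _ 0]) auto
  have wv: "(\<Sum>k<n. w k * v $ k) = c"
    by (simp add: w_def c_def left_diff_distrib sum_subtractf vv d0)
  have "(\<Sum>k<n. w k * w k) = (\<Sum>k<n. w k * v $ k) - (\<Sum>k<n. of_bool (k = 0) * w k)"
    unfolding sum_subtractf[symmetric] by (rule sum.cong) (auto simp: w_def algebra_simps)
  also have "\<dots> = 2 * c" unfolding wv d0 by (simp add: w_def c_def)
  finally have ww: "(\<Sum>k<n. w k * w k) = 2 * c" .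
  have di: "(\<Sum>k<n. of_bool (i = k) * f k) = f i" "(\<Sum>k<n. of_bool (k = i) * f k) = f i"
    if "i < n" for i and f :: "nat \<Rightarrow> real"
    using that by (subst sum.remove[of _ i]; auto)+
  have H: "H \<in> carrier_mat n n" by (simp add: H_def)
  moreover have "transpose_mat H = H"
    unfolding H_def by (rule eq_matI) auto
  moreover have "H * H = 1\<^sub>m n"
  proof (rule eq_matI)
    fix i j assume "i < dim_row (1\<^sub>m n :: real mat)" "j < dim_col (1\<^sub>m n :: real mat)"
    then have ij: "i < n" "j < n" by auto
    have "(H * H) $$ (i, j) =
        (\<Sum>k<n. (of_bool (i = k) - w i * w k / c) * (of_bool (k = j) - w k * w j / c))"
      using ij by (simp add: H_def scalar_prod_def atLeast0LessThan)
    also have "\<dots> = (\<Sum>k<n. of_bool (i = k) * of_bool (k = j) - of_bool (i = k) * (w k * w j / c)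
        - of_bool (k = j) * (w i * w k / c) + (w k * w k) * (w i * w j / c\<^sup>2))"
      by (rule sum.cong) (auto simp: algebra_simps power2_eq_square)
    also have "\<dots> = of_bool (i = j) - w i * w j / c - w i * w j / c + 2 * c * (w i * w j / c\<^sup>2)"
      using ij by (simp add: sum.distrib sum_subtractf di ww del: times_divide_eq_right times_divide_eq_left flip: sum_distrib_right)
    also have "\<dots> = of_bool (i = j)" using c by (simp add: power2_eq_square)
    finally show "(H * H) $$ (i, j) = 1\<^sub>m n $$ (i, j)" using ij by simp
  qed (simp_all add: H_def)
  moreover have "H *\<^sub>v v = unit_vec n 0"
  proof (rule eq_vecI)
    fix i assume "i < dim_vec (unit_vec n 0 :: real vec)"
    then have i: "i < n" by simp
    have "(H *\<^sub>v v) $ i = (\<Sum>k<n. (of_bool (i = k) - w i * w k / c) * v $ k)"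
      using i v by (simp add: H_def scalar_prod_def atLeast0LessThan)
    also have "\<dots> = (\<Sum>k<n. of_bool (i = k) * v $ k - (w k * v $ k) * (w i / c))"
      by (rule sum.cong) (auto simp: algebra_simps)
    also have "\<dots> = v $ i - c * (w i / c)"
      using i by (simp add: sum_subtractf di wv del: times_divide_eq_right times_divide_eq_left flip: sum_distrib_right)
    also have "\<dots> = unit_vec n 0 $ i" using c i n by (simp add: w_def)
    finally show "(H *\<^sub>v v) $ i = unit_vec n 0 $ i" .
  qed (simp add: H_def)
  ultimately show thesis by (rule that)
qed

text \<open>Deflation: the reflection \<open>H\<close> carries a unit eigenvector to the first unit
  vector. The conjugate \<open>H * A * H\<close> is again symmetric, so its first row and column
  vanish off the diagonal, and the induction hypothesis diagonalises the remaining block.\<close>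

theorem spectral_theorem_symmetric_real:
  fixes A :: "real mat"
  assumes "A \<in> carrier_mat n n" "transpose_mat A = A"
  shows "\<exists>D P. similar_mat_wit A D P (transpose_mat P) \<and> diagonal_mat D"
  using assms
proof (induction n arbitrary: A)
  case 0
  then have "similar_mat_wit A A (1\<^sub>m 0) (1\<^sub>m 0)" by (intro similar_mat_wit_refl)
  moreover have "diagonal_mat A" using 0 by (auto simp: diagonal_mat_def)
  ultimately show ?case by (metis transpose_one)
next
  case (Suc n)
  let ?n = "Suc n"
  note A = Suc.prems(1)
  obtain u e where u: "eigenvector A u e"
    using symmetric_real_mat_eigenvector[OF Suc.prems] by blast
  have uc: "u \<in> carrier_vec ?n" and u0: "u \<noteq> 0\<^sub>v ?n" and Au: "A *\<^sub>v u = e \<cdot>\<^sub>v u"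
    using u A unfolding eigenvector_def by auto
  have uu: "u \<bullet> u > 0"
    using conjugate_square_greater_0_vec[OF uc] u0 by (simp add: scalar_prod_def)
  \<comment> \<open>Of the two unit multiples of \<open>u\<close>, at least one has an entry other
    than 1 at index 0, as the reflection requires.\<close>
  obtain s where s: "(s * u $ 0) \<noteq> 1" "s * s * (u \<bullet> u) = 1"
  proof -
    let ?s = "1 / sqrt (u \<bullet> u)"
    have "?s * ?s * (u \<bullet> u) = 1" "(- ?s) * (- ?s) * (u \<bullet> u) = 1"
      using uu by (auto simp: real_sqrt_mult_self)
    moreover have "?s * u $ 0 \<noteq> 1 \<or> (- ?s) * u $ 0 \<noteq> 1" by linarith
    ultimately show thesis using that by blast
  qed
  define v where "v = s \<cdot>\<^sub>v u"
  have vc: "v \<in> carrier_vec ?n" using uc by (simp add: v_def)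
  have vv: "v \<bullet> v = 1" using uc s(2) by (simp add: v_def mult.assoc)
  have v0: "v $ 0 \<noteq> 1" using uc s(1) by (simp add: v_def)
  have Av: "A *\<^sub>v v = e \<cdot>\<^sub>v v"
    using A uc Au by (simp add: v_def mult_mat_vec smult_smult_assoc mult.commute)
  obtain H where H: "H \<in> carrier_mat ?n ?n" "transpose_mat H = H" "H * H = 1\<^sub>m ?n"
    and Hv: "H *\<^sub>v v = unit_vec ?n 0"
    using orthogonal_involution_to_unit_vec[OF vc _ vv v0] by blast
  define B where "B = H * A * H"
  have B: "B \<in> carrier_mat ?n ?n" using A H by (simp add: B_def)
  have AB: "similar_mat_wit A B H H"
  proof (rule similar_mat_witI[OF H(3) H(3) _ A B H(1) H(1)])
    have "H * B * H = (H * H) * A * (H * H)"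
      using A H(1) by (simp add: B_def assoc_mult_mat[of _ ?n ?n _ ?n _ ?n])
    then show "A = H * B * H" using A by (simp add: H(3))
  qed
  have symB: "transpose_mat B = B"
    using A H Suc.prems(2) by (simp add: B_def transpose_mult[of _ ?n ?n _ ?n] assoc_mult_mat[of _ ?n ?n _ ?n _ ?n])
  have "H *\<^sub>v unit_vec ?n 0 = v"
    using assoc_mult_mat_vec[OF H(1) H(1) vc] vc by (simp add: Hv H(3))
  then have "B *\<^sub>v unit_vec ?n 0 = e \<cdot>\<^sub>v unit_vec ?n 0"
    using A H(1) vc by (simp add: B_def assoc_mult_mat_vec[of _ ?n ?n _ ?n] Av Hv mult_mat_vec)
  then have col: "B $$ (i, 0) = (if i = 0 then e else 0)" if "i < ?n" for i
    using that B scalar_prod_right_unit[of 0 ?n "Matrix.row B i"]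
    by (metis carrier_matD index_mult_mat_vec index_row(1) index_smult_vec(1) index_unit_vec(1,3)
        mult.right_neutral mult_zero_right row_carrier_vec zero_less_Suc)
  have row: "B $$ (0, i) = (if i = 0 then e else 0)" if "i < ?n" for i
    using col[OF that] symB B that by (metis carrier_matD index_transpose_mat(1) zero_less_Suc)
  define C where "C = Matrix.mat n n (\<lambda>(i, j). B $$ (Suc i, Suc j))"
  have C: "C \<in> carrier_mat n n" by (simp add: C_def)
  let ?E = "Matrix.mat 1 1 (\<lambda>_. e)"
  have E: "?E \<in> carrier_mat 1 1" by simp
  have BC: "B = four_block_mat ?E (0\<^sub>m 1 n) (0\<^sub>m n 1) C"
    using B by (intro eq_matI) (auto simp: C_def col row)
  have "transpose_mat C = C"
    unfolding C_def using symB B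
    by (intro eq_matI) (auto, metis Suc_mono carrier_matD index_transpose_mat(1))
  from Suc.IH[OF C this] obtain D P where
    CD: "similar_mat_wit C D P (transpose_mat P)" and D: "diagonal_mat D" by blast
  note CDD = similar_mat_witD2[OF C CD]
  let ?D = "four_block_mat ?E (0\<^sub>m 1 n) (0\<^sub>m n 1) D"
  let ?P = "four_block_mat (1\<^sub>m 1) (0\<^sub>m 1 n) (0\<^sub>m n 1) P"
  let ?Q = "four_block_mat (1\<^sub>m 1) (0\<^sub>m 1 n) (0\<^sub>m n 1) (transpose_mat P)"
  have "similar_mat_wit B ?D ?P ?Q"
    unfolding BC
    by (rule similar_mat_wit_four_block[OF similar_mat_wit_refl[OF E] CD _ _ E C])
      (use CDD in auto)
  from similar_mat_wit_trans[OF AB this]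
  have "similar_mat_wit A ?D (H * ?P) (?Q * H)" .
  moreover have "?Q = transpose_mat ?P"
    using CDD by (subst transpose_four_block_mat[of _ 1 1 _ n _ n]) auto
  then have "?Q * H = transpose_mat (H * ?P)"
    using H CDD by (subst transpose_mult[of _ ?n ?n _ ?n]) auto
  moreover have "diagonal_mat ?D"
    using D CDD unfolding diagonal_mat_def by auto
  ultimately show ?case by metis
qed

section \<open>Eigenvalue counts and the sign of the form on a hyperplane\<close>

lemma proots_prod_linear_factors:
  "proots (\<Prod>a\<leftarrow>xs. [:- a, 1:]) = mset (xs :: 'a :: idom list)"
proof (induction xs)
  case (Cons a xs)
  have "(\<Prod>a\<leftarrow>xs. [:- a, 1:]) \<noteq> 0" unfolding prod_list_zero_iff by auto
  then show ?case using Cons.IH by (simp add: proots_mult del: mult_pCons_left)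
qed simp

text \<open>Similar matrices share the characteristic polynomial, and that of a diagonal matrix
  splits into linear factors given by the diagonal. Counting eigenvalues thus becomes counting
  diagonal entries.\<close>

lemma size_filter_eigenvalues_diagonal:
  assumes A: "A \<in> carrier_mat n n" and D: "similar_mat_wit A D P Q" "diagonal_mat D"
  shows "size (filter_mset R (eigenvalues_mset A)) = card {i. i < n \<and> R (D $$ (i, i))}"
proof -
  note DD = similar_mat_witD2[OF A D(1)]
  have "char_poly A = char_poly D"
    using D(1) by (intro char_poly_similar) (auto simp: similar_mat_def)
  also have "\<dots> = (\<Prod>a\<leftarrow>diag_mat D. [:- a, 1:])"
    using D(2) DD(5) by (intro char_poly_upper_triangular) (auto simp: diagonal_mat_def upper_triangular_def)
  finally have "eigenvalues_mset A = proots (\<Prod>a\<leftarrow>diag_mat D. [:- a, 1:])"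
    by (simp add: eigenvalues_mset_def)
  also have "\<dots> = mset (diag_mat D)"
    by (rule proots_prod_linear_factors)
  finally have "size (filter_mset R (eigenvalues_mset A)) = length (filter R (diag_mat D))"
    by (simp flip: mset_filter)
  also have "\<dots> = card {i. i < n \<and> R (D $$ (i, i))}"
    using DD(5) by (auto simp: length_filter_conv_card diag_mat_def intro!: arg_cong[where f = card])
  finally show ?thesis .
qed

lemma quadratic_form_diagonalised:
  fixes A :: "real mat"
  assumes A: "A \<in> carrier_mat n n" and D: "similar_mat_wit A D P (transpose_mat P)" "diagonal_mat D"
    and x: "x \<in> carrier_vec n"
  shows "x \<bullet> (A *\<^sub>v x) = (\<Sum>i<n. D $$ (i, i) * (col P i \<bullet> x)\<^sup>2)"
proof -
  note DD = similar_mat_witD2[OF A D(1)]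
  define y where "y = transpose_mat P *\<^sub>v x"
  have y: "y \<in> carrier_vec n" "D *\<^sub>v y \<in> carrier_vec n" using DD x by (auto simp: y_def)
  have "A *\<^sub>v x = P *\<^sub>v (D *\<^sub>v y)"
    using DD x by (simp add: DD(3) y_def assoc_mult_mat_vec[of _ n n _ n])
  then have "x \<bullet> (A *\<^sub>v x) = y \<bullet> (D *\<^sub>v y)"
    using transpose_vec_mult_scalar[OF DD(6) y(2) x] by (simp add: y_def)
  also have "\<dots> = (\<Sum>i<n. y $ i * (\<Sum>j<n. D $$ (i, j) * y $ j))"
    using y(1) DD(5) by (simp add: scalar_prod_def atLeast0LessThan)
  also have "\<dots> = (\<Sum>i<n. D $$ (i, i) * (y $ i)\<^sup>2)"
  proof (rule sum.cong)
    fix i assume i: "i \<in> {..<n}"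
    have "(\<Sum>j<n. D $$ (i, j) * y $ j) = (\<Sum>j\<in>{i}. D $$ (i, j) * y $ j)"
      using i D(2) DD(5) by (intro sum.mono_neutral_right) (auto simp: diagonal_mat_def)
    then show "y $ i * (\<Sum>j<n. D $$ (i, j) * y $ j) = D $$ (i, i) * (y $ i)\<^sup>2"
      by (simp add: power2_eq_square)
  qed simp
  also have "\<dots> = (\<Sum>i<n. D $$ (i, i) * (col P i \<bullet> x)\<^sup>2)"
    using DD(6) by (intro sum.cong) (auto simp: y_def)
  finally show ?thesis .
qed

lemma card_le_one_subset_singleton:
  assumes "finite S" "card S \<le> 1" shows "\<exists>a. S \<subseteq> {a}"
  using assms by (metis card_le_Suc0_iff_eq One_nat_def insertCI subsetI subset_singleton_iff)

text \<open>In the diagonalised form at most one summand has a positive coefficient, and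
  orthogonality to the matching column of \<open>P\<close> kills it. A plane on which the form is
  positive definite will contradict this, because it meets every hyperplane.\<close>

lemma nonpos_on_hyperplane_if_num_pos_eigenvalues_le_1:
  fixes A :: "real mat"
  assumes A: "A \<in> carrier_mat n n" "transpose_mat A = A" and num: "num_pos_eigenvalues A \<le> 1"
  obtains r where "r \<in> carrier_vec n" "\<And>x. x \<in> carrier_vec n \<Longrightarrow> r \<bullet> x = 0 \<Longrightarrow> x \<bullet> (A *\<^sub>v x) \<le> 0"
proof -
  obtain D P where D: "similar_mat_wit A D P (transpose_mat P)" "diagonal_mat D"
    using spectral_theorem_symmetric_real[OF A] by blast
  have "card {i. i < n \<and> D $$ (i, i) > 0} \<le> 1"
    using num size_filter_eigenvalues_diagonal[OF A(1) D] by (simp add: num_pos_eigenvalues_def)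
  then obtain a where a: "{i. i < n \<and> D $$ (i, i) > 0} \<subseteq> {a}"
    using card_le_one_subset_singleton[of "{i. i < n \<and> D $$ (i, i) > 0}"] by auto
  show thesis
  proof (rule that)
    \<comment> \<open>If no diagonal entry is positive, \<open>a\<close> is arbitrary and may lie
      outside the index range; the zero vector is then a valid choice.\<close>
    show "(if a < n then col P a else 0\<^sub>v n) \<in> carrier_vec n"
      using similar_mat_witD2(6)[OF A(1) D(1)] by auto
    fix x assume x: "x \<in> carrier_vec n" and ax: "(if a < n then col P a else 0\<^sub>v n) \<bullet> x = 0"
    have "D $$ (i, i) * (col P i \<bullet> x)\<^sup>2 \<le> 0" if "i < n" for i
    proof (cases "i = a")
      case False
      then have "D $$ (i, i) \<le> 0" using a that by force
      then show ?thesis by (simp add: mult_nonpos_nonneg)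
    qed (use ax that in auto)
    then show "x \<bullet> (A *\<^sub>v x) \<le> 0"
      unfolding quadratic_form_diagonalised[OF A(1) D x] by (intro sum_nonpos) auto
  qed
qed

text \<open>The same argument with the signs reversed: the chosen column of \<open>P\<close> belongs
  to the only possible negative diagonal entry.\<close>

lemma nonneg_on_hyperplane_if_num_neg_eigenvalues_le_1:
  fixes A :: "real mat"
  assumes A: "A \<in> carrier_mat n n" "transpose_mat A = A" and num: "num_neg_eigenvalues A \<le> 1"
  obtains r where "r \<in> carrier_vec n" "\<And>x. x \<in> carrier_vec n \<Longrightarrow> r \<bullet> x = 0 \<Longrightarrow> x \<bullet> (A *\<^sub>v x) \<ge> 0"
proof -
  obtain D P where D: "similar_mat_wit A D P (transpose_mat P)" "diagonal_mat D"
    using spectral_theorem_symmetric_real[OF A] by blast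
  have "card {i. i < n \<and> D $$ (i, i) < 0} \<le> 1"
    using num size_filter_eigenvalues_diagonal[OF A(1) D] by (simp add: num_neg_eigenvalues_def)
  then obtain a where a: "{i. i < n \<and> D $$ (i, i) < 0} \<subseteq> {a}"
    using card_le_one_subset_singleton[of "{i. i < n \<and> D $$ (i, i) < 0}"] by auto
  show thesis
  proof (rule that)
    show "(if a < n then col P a else 0\<^sub>v n) \<in> carrier_vec n"
      using similar_mat_witD2(6)[OF A(1) D(1)] by auto
    fix x assume x: "x \<in> carrier_vec n" and ax: "(if a < n then col P a else 0\<^sub>v n) \<bullet> x = 0"
    have "D $$ (i, i) * (col P i \<bullet> x)\<^sup>2 \<ge> 0" if "i < n" for i
    proof (cases "i = a")
      case False
      then have "D $$ (i, i) \<ge> 0" using a that by force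
      then show ?thesis by simp
    qed (use ax that in auto)
    then show "x \<bullet> (A *\<^sub>v x) \<ge> 0"
      unfolding quadratic_form_diagonalised[OF A(1) D x] by (intro sum_nonneg) auto
  qed
qed

section \<open>The quadratic form\<close>

definition mean :: "nat \<Rightarrow> (nat \<Rightarrow> real) \<Rightarrow> real" where
  "mean n p = 1 / 2 ^ (n - 1) * (\<Sum>k = 0..n - 1. real ((n - 1) choose k) * p (k + 1))"

text \<open>The symmetric bilinear form with \<open>psi\<close> on its diagonal. The product in
  \<open>psi\<close> couples two different indices, hence the symmetrised half sum.\<close>

definition polar :: "nat \<Rightarrow> (nat \<Rightarrow> real) \<Rightarrow> (nat \<Rightarrow> real) \<Rightarrow> real" where
  "polar n p q = mean n p * mean n q - 1 / 2 ^ (n - 1) *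
     (\<Sum>k = 0..n - 2. real ((n - 2) choose k) *
        (p (k + 2) * q (k + 2) + (p (k + 1) * q (n - (k + 1)) + q (k + 1) * p (n - (k + 1))) / 2))"

lemma psi_eq_polar: "psi n p = polar n p p"
  by (simp add: psi_def polar_def mean_def power2_eq_square)

lemma mean_lincomb: "mean n (\<lambda>k. \<alpha> * p k + \<beta> * q k) = \<alpha> * mean n p + \<beta> * mean n q"
proof -
  have "(\<Sum>k = 0..n - 1. real ((n - 1) choose k) * (\<alpha> * p (k + 1) + \<beta> * q (k + 1))) =
      \<alpha> * (\<Sum>k = 0..n - 1. real ((n - 1) choose k) * p (k + 1)) +
      \<beta> * (\<Sum>k = 0..n - 1. real ((n - 1) choose k) * q (k + 1))"
    unfolding sum_distrib_left sum.distrib[symmetric] by (rule sum.cong) (auto simp: algebra_simps)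
  then show ?thesis by (simp add: mean_def algebra_simps)
qed

lemma polar_commute: "polar n p q = polar n q p"
  by (simp add: polar_def algebra_simps)

lemma polar_lincomb_right:
  "polar n r (\<lambda>k. \<alpha> * p k + \<beta> * q k) = \<alpha> * polar n r p + \<beta> * polar n r q"
proof -
  define w where "w k = real ((n - 2) choose k)" for k
  define t where "t p k = r (k + 2) * p (k + 2) + (r (k + 1) * p (n - (k + 1)) + p (k + 1) * r (n - (k + 1))) / 2"
    for p :: "nat \<Rightarrow> real" and k
  have "(\<Sum>k = 0..n - 2. w k * t (\<lambda>k. \<alpha> * p k + \<beta> * q k) k) =
      \<alpha> * (\<Sum>k = 0..n - 2. w k * t p k) + \<beta> * (\<Sum>k = 0..n - 2. w k * t q k)"
    unfolding sum_distrib_left sum.distrib[symmetric]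
    by (rule sum.cong) (auto simp: t_def field_simps)
  moreover define c :: real where "c = 1 / 2 ^ (n - 1)"
  have polar: "polar n r p = mean n r * mean n p - c * (\<Sum>k = 0..n - 2. w k * t p k)" for p
    by (simp add: polar_def w_def t_def c_def)
  ultimately show ?thesis unfolding polar mean_lincomb by (simp add: algebra_simps)
qed

lemma psi_lincomb:
  "psi n (\<lambda>k. \<alpha> * p k + \<beta> * q k) = \<alpha>\<^sup>2 * psi n p + 2 * \<alpha> * \<beta> * polar n p q + \<beta>\<^sup>2 * psi n q"
  unfolding psi_eq_polar polar_lincomb_right polar_commute[of n "\<lambda>k. \<alpha> * p k + \<beta> * q k"]
  by (simp add: polar_commute[of n q p] algebra_simps power2_eq_square)

lemma mean_const: "mean n (\<lambda>_. c) = c"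
proof -
  have "(\<Sum>k = 0..n - 1. real ((n - 1) choose k) * c) = real (\<Sum>k\<le>n - 1. (n - 1) choose k) * c"
    by (simp add: atMost_atLeast0 sum_distrib_right)
  then show ?thesis by (simp add: mean_def choose_row_sum)
qed

text \<open>Constants lie in the radical of the form. Reversing the order of summation turns the
  entries at \<open>n - (k + 1)\<close> into those at \<open>k + 1\<close>, and Pascal's rule
  combines them with the entries at \<open>k + 2\<close> into the sum that defines
  \<open>mean\<close>.\<close>

lemma polar_const:
  assumes "n \<ge> 2" shows "polar n p (\<lambda>_. c) = 0"
proof -
  obtain m where n: "n = m + 2" using assms by (metis add.commute le_Suc_ex)
  have rev: "(\<Sum>k\<le>m. real (m choose k) * p (m + 1 - k)) = (\<Sum>k\<le>m. real (m choose k) * p (k + 1))"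
    by (rule sum.reindex_bij_witness[of _ "\<lambda>k. m - k" "\<lambda>k. m - k"])
       (auto simp: binomial_symmetric[symmetric] Suc_diff_le)
  have pascal: "(\<Sum>k\<le>m + 1. real ((m + 1) choose k) * p (k + 1)) =
      (\<Sum>k\<le>m. real (m choose k) * p (k + 2)) + (\<Sum>k\<le>m. real (m choose k) * p (k + 1))"
  proof -
    have "(\<Sum>k\<le>m + 1. real ((m + 1) choose k) * p (k + 1)) =
        p 1 + (\<Sum>k\<le>m. real ((m + 1) choose (k + 1)) * p (k + 2))"
      by (simp add: sum.atMost_Suc_shift del: sum.atMost_Suc binomial_Suc_Suc)
    also have "\<dots> = (\<Sum>k\<le>m. real (m choose k) * p (k + 2)) +
        (p 1 + (\<Sum>k\<le>m. real (m choose (k + 1)) * p (k + 2)))"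
      by (simp add: sum.distrib algebra_simps)
    also have "p 1 + (\<Sum>k\<le>m. real (m choose (k + 1)) * p (k + 2)) = (\<Sum>k\<le>m + 1. real (m choose k) * p (k + 1))"
      by (simp add: sum.atMost_Suc_shift del: sum.atMost_Suc)
    finally show ?thesis by simp
  qed
  have "(\<Sum>k\<le>m. real (m choose k) * (p (k + 2) * c + (p (k + 1) * c + c * p (m + 1 - k)) / 2)) =
      c * ((\<Sum>k\<le>m. real (m choose k) * p (k + 2)) + ((\<Sum>k\<le>m. real (m choose k) * p (k + 1))
        + (\<Sum>k\<le>m. real (m choose k) * p (m + 1 - k))) / 2)"
    unfolding sum_distrib_left sum_divide_distrib sum.distrib[symmetric]
    by (rule sum.cong) (auto simp: algebra_simps)
  also have "\<dots> = c * (\<Sum>k\<le>m + 1. real ((m + 1) choose k) * p (k + 1))"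
    unfolding rev pascal by simp
  finally show ?thesis
    unfolding polar_def mean_const
    by (simp add: mean_def n atLeast0AtMost mult.commute)
qed

text \<open>Points of the cube are \<open>undefined\<close> outside \<open>{1..n}\<close>; this
  permits computing with unrestricted formulas instead. For \<open>n = 1\<close> truncated
  subtraction would make \<open>psi\<close> read the indices 0 and 2.\<close>

lemma psi_cong:
  assumes "n \<ge> 2" "\<And>k. k \<in> {1..n} \<Longrightarrow> p k = q k" shows "psi n p = psi n q"
proof -
  have "(\<Sum>k = 0..n - 1. real ((n - 1) choose k) * p (k + 1)) =
      (\<Sum>k = 0..n - 1. real ((n - 1) choose k) * q (k + 1))"
    using assms by (intro sum.cong) auto
  moreover have "(\<Sum>k = 0..n - 2. real ((n - 2) choose k) * ((p (k + 2))\<^sup>2 + p (k + 1) * p (n - (k + 1)))) =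
      (\<Sum>k = 0..n - 2. real ((n - 2) choose k) * ((q (k + 2))\<^sup>2 + q (k + 1) * q (n - (k + 1))))"
    using assms by (intro sum.cong refl arg_cong2[where f = "(*)"] arg_cong2[where f = "(+)"] arg_cong[where f = "\<lambda>x. x\<^sup>2"]) auto
  ultimately show ?thesis unfolding psi_def by simp
qed

text \<open>As constants are in the radical, the zero cone may be recentred at the middle of the
  cube.\<close>

lemma psi_translate:
  assumes "n \<ge> 2" shows "psi n (\<lambda>k. p k + c) = psi n p"
proof -
  have "psi n (\<lambda>_. c) = 0" using polar_const[OF assms] by (simp add: psi_eq_polar)
  then show ?thesis
    using psi_lincomb[of n 1 p 1 "\<lambda>_. c"] polar_const[OF assms] by simp
qed

lemma sum_point: "k \<in> S \<Longrightarrow> finite S \<Longrightarrow> (\<Sum>i\<in>S. f i * of_bool (k = i)) = (f k :: real)"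
  by (subst sum.remove[of _ k]) auto

section \<open>The Hessian as the matrix of the form\<close>

text \<open>Euler's identity for a quadratic form: contracting the second derivatives twice with
  \<open>p\<close> gives twice the form. The indicators in \<open>ddpsi\<close> collapse the double
  sum.\<close>

lemma psi_eq_ddpsi:
  assumes "n \<ge> 2"
  shows "2 * psi n p = (\<Sum>i = 1..n. \<Sum>j = 1..n. p i * p j * ddpsi n i j)"
proof -
  define c :: real where "c = 1 / 2 ^ (n - 1)"
  define w where "w k = real ((n - 2) choose k)" for k
  \<comment> \<open>\<open>m i\<close> is the coefficient of \<open>p i\<close> in
    \<open>mean n p\<close>, and \<open>t k i j\<close> is the mixed second derivative of the
    summand with index \<open>k\<close> in the second part of \<open>psi\<close>.\<close>
  define m where "m i = c * (\<Sum>k = 0..n - 1. real ((n - 1) choose k) * of_bool (k + 1 = i))" for i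
  define t where "t k i j = (2 * of_bool (k + 2 = i) * of_bool (k + 2 = j)
           + (of_bool (k + 1 = j) * of_bool (n - (k + 1) = i) + of_bool (k + 1 = i) * of_bool (n - (k + 1) = j)) :: real)"
    for k i j
  have dd: "ddpsi n i j = 2 * m i * m j - c * (\<Sum>k = 0..n - 2. w k * t k i j)" for i j
    by (simp add: ddpsi_def m_def c_def w_def t_def)
  have pm: "(\<Sum>i = 1..n. p i * m i) = mean n p"
  proof -
    have "(\<Sum>i = 1..n. p i * m i) = c * (\<Sum>i = 1..n. \<Sum>k = 0..n - 1. real ((n - 1) choose k) * (p i * of_bool (k + 1 = i)))"
      unfolding m_def sum_distrib_left by (intro sum.cong) (auto simp: algebra_simps)
    also have "\<dots> = c * (\<Sum>k = 0..n - 1. real ((n - 1) choose k) * (\<Sum>i = 1..n. p i * of_bool (k + 1 = i)))"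
      by (subst sum.swap) (simp only: sum_distrib_left)
    also have "\<dots> = mean n p"
      unfolding mean_def c_def using assms
      by (intro arg_cong2[where f = "(*)"] sum.cong refl sum_point) auto
    finally show ?thesis .
  qed
  have pt: "(\<Sum>i = 1..n. \<Sum>j = 1..n. p i * p j * t k i j) = 2 * ((p (k + 2))\<^sup>2 + p (k + 1) * p (n - (k + 1)))"
    if k: "k \<in> {0..n - 2}" for k
  proof -
    have "(\<Sum>i = 1..n. \<Sum>j = 1..n. p i * p j * t k i j) =
       (\<Sum>i = 1..n. \<Sum>j = 1..n. 2 * ((p i * of_bool (k + 2 = i)) * (p j * of_bool (k + 2 = j)))
         + ((p i * of_bool (n - (k + 1) = i)) * (p j * of_bool (k + 1 = j))
          + (p i * of_bool (k + 1 = i)) * (p j * of_bool (n - (k + 1) = j))))"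
      by (intro sum.cong refl) (simp add: t_def algebra_simps)
    also have "\<dots> = 2 * ((\<Sum>i = 1..n. p i * of_bool (k + 2 = i)) * (\<Sum>j = 1..n. p j * of_bool (k + 2 = j)))
         + ((\<Sum>i = 1..n. p i * of_bool (n - (k + 1) = i)) * (\<Sum>j = 1..n. p j * of_bool (k + 1 = j))
          + (\<Sum>i = 1..n. p i * of_bool (k + 1 = i)) * (\<Sum>j = 1..n. p j * of_bool (n - (k + 1) = j)))"
      by (simp only: sum.distrib sum_product) (simp only: sum_distrib_left)
    also have "\<dots> = 2 * (p (k + 2) * p (k + 2)) + (p (n - (k + 1)) * p (k + 1) + p (k + 1) * p (n - (k + 1)))"
      by (intro arg_cong2[where f = "(*)"] arg_cong2[where f = "(+)"] refl sum_point)
         (use k assms in auto)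
    finally show ?thesis by (simp add: power2_eq_square algebra_simps)
  qed
  have "(\<Sum>i = 1..n. \<Sum>j = 1..n. p i * p j * ddpsi n i j) =
      (\<Sum>i = 1..n. \<Sum>j = 1..n. 2 * ((p i * m i) * (p j * m j)) - c * (\<Sum>k = 0..n - 2. w k * (p i * p j * t k i j)))"
    unfolding dd by (intro sum.cong refl) (simp add: algebra_simps sum_distrib_left)
  also have "\<dots> = 2 * ((\<Sum>i = 1..n. p i * m i) * (\<Sum>j = 1..n. p j * m j)) -
      c * (\<Sum>i = 1..n. \<Sum>j = 1..n. \<Sum>k = 0..n - 2. w k * (p i * p j * t k i j))"
    by (simp only: sum_subtractf sum_product) (simp only: sum_distrib_left)
  also have "(\<Sum>i = 1..n. \<Sum>j = 1..n. \<Sum>k = 0..n - 2. w k * (p i * p j * t k i j)) =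
      (\<Sum>i = 1..n. \<Sum>k = 0..n - 2. \<Sum>j = 1..n. w k * (p i * p j * t k i j))"
    by (rule sum.cong[OF refl], rule sum.swap)
  also have "\<dots> = (\<Sum>k = 0..n - 2. \<Sum>i = 1..n. \<Sum>j = 1..n. w k * (p i * p j * t k i j))"
    by (rule sum.swap)
  also have "\<dots> = (\<Sum>k = 0..n - 2. w k * (\<Sum>i = 1..n. \<Sum>j = 1..n. p i * p j * t k i j))"
    by (simp only: sum_distrib_left)
  also have "\<dots> = (\<Sum>k = 0..n - 2. w k * (2 * ((p (k + 2))\<^sup>2 + p (k + 1) * p (n - (k + 1)))))"
    by (intro sum.cong refl) (simp only: pt)
  also have "\<dots> = 2 * (\<Sum>k = 0..n - 2. w k * ((p (k + 2))\<^sup>2 + p (k + 1) * p (n - (k + 1))))"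
    unfolding sum_distrib_left by (intro sum.cong) auto
  finally show ?thesis
    unfolding pm by (simp add: psi_def mean_def c_def w_def power2_eq_square)
qed

lemma Hess_carrier: "Hess n \<in> carrier_mat n n"
  by (simp add: Hess_def hessian_def)

lemma Hess_nth: "i < n \<Longrightarrow> j < n \<Longrightarrow> Hess n $$ (i, j) = ddpsi n (Suc i) (Suc j)"
  by (simp add: Hess_def hessian_def partial_deriv_psi partial_deriv_dpsi)

lemma Hess_symmetric: "transpose_mat (Hess n) = Hess n"
proof (rule eq_matI)
  fix i j assume "i < dim_row (Hess n)" "j < dim_col (Hess n)"
  then have ij: "i < n" "j < n" using Hess_carrier[of n] by auto
  have "ddpsi n (Suc j) (Suc i) = ddpsi n (Suc i) (Suc j)"
    unfolding ddpsi_def by (simp add: mult.commute mult.left_commute add.commute)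
  then show "transpose_mat (Hess n) $$ (i, j) = Hess n $$ (i, j)"
    using ij Hess_carrier[of n] by (simp add: Hess_nth)
qed (use Hess_carrier[of n] in auto)

lemma Hess_quadratic_form:
  assumes "n \<ge> 2"
  shows "vec n (\<lambda>i. p (Suc i)) \<bullet> (Hess n *\<^sub>v vec n (\<lambda>i. p (Suc i))) = 2 * psi n p"
proof -
  have "vec n (\<lambda>i. p (Suc i)) \<bullet> (Hess n *\<^sub>v vec n (\<lambda>i. p (Suc i))) =
      (\<Sum>i<n. \<Sum>j<n. p (Suc i) * p (Suc j) * ddpsi n (Suc i) (Suc j))"
    using Hess_carrier[of n]
    by (auto simp: scalar_prod_def atLeast0LessThan Hess_nth sum_distrib_left mult_ac intro!: sum.cong)
  also have "\<dots> = (\<Sum>i = 1..n. \<Sum>j = 1..n. p i * p j * ddpsi n i j)"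
    by (simp add: sum.atLeast1_atMost_eq)
  finally show ?thesis by (simp add: psi_eq_ddpsi[OF assms])
qed

section \<open>Planes on which the form is definite\<close>

lemma real_choose_Suc_Suc_2: "real (Suc (Suc j) choose Suc (Suc 0)) = real (Suc (Suc j)) * real (Suc j) / 2"
proof (induction j)
  case (Suc j)
  have "Suc (Suc (Suc j)) choose Suc (Suc 0) = Suc (Suc j) + (Suc (Suc j) choose Suc (Suc 0))"
    by (subst binomial_Suc_Suc) (simp del: binomial_Suc_Suc)
  then show ?case by (simp only: of_nat_add Suc.IH) (simp add: field_simps)
qed simp

lemma real_choose_Suc_Suc_self: "real (Suc (Suc j) choose j) = real (Suc (Suc j)) * real (Suc j) / 2"
  using binomial_symmetric[of j "Suc (Suc j)"] real_choose_Suc_Suc_2[of j]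
  by (simp add: numeral_2_eq_2 del: binomial_Suc_Suc)

text \<open>With \<open>n = m + 5\<close> the support lies in 1, 2, \<open>n - 2\<close>,
  \<open>n - 1\<close>, \<open>n\<close>, where all binomial weights are at most quadratic in
  \<open>n\<close>. The product term couples \<open>j\<close> with \<open>n - j\<close>, that is 1
  with \<open>n - 1\<close> and 2 with \<open>n - 2\<close>; each pair occurs twice.\<close>

lemma psi_support_5:
  assumes "\<forall>k \<in> {3..m + 2}. p k = 0"
  shows "psi (m + 5) p =
    ((p 1 + real (m + 4) * p 2 + real (m + 4) * real (m + 3) / 2 * p (m + 3) + real (m + 4) * p (m + 4) + p (m + 5)) / 2 ^ (m + 4))\<^sup>2
    - ((p 2)\<^sup>2 + real (m + 3) * real (m + 2) / 2 * (p (m + 3))\<^sup>2 + real (m + 3) * (p (m + 4))\<^sup>2 + (p (m + 5))\<^sup>2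
       + 2 * p 1 * p (m + 4) + 2 * real (m + 3) * p 2 * p (m + 3)) / 2 ^ (m + 4)"
proof -
  have 1: "(\<Sum>k = 0..m + 4. real ((m + 4) choose k) * p (k + 1)) =
      p 1 + real (m + 4) * p 2 + real (m + 4) * real (m + 3) / 2 * p (m + 3) + real (m + 4) * p (m + 4) + p (m + 5)"
    (is "_ = ?X")
  proof -
    have "(\<Sum>k = 0..m + 4. real ((m + 4) choose k) * p (k + 1)) =
        (\<Sum>k\<in>{0, 1, m + 2, m + 3, m + 4}. real ((m + 4) choose k) * p (k + 1))"
      using assms by (intro sum.mono_neutral_right) auto
    also have "\<dots> = ?X"
      by (simp add: real_choose_Suc_Suc_self eval_nat_numeral del: binomial_Suc_Suc)
    finally show ?thesis .
  qed
  have 2: "(\<Sum>k = 0..m + 3. real ((m + 3) choose k) * (p (k + 2))\<^sup>2) =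
      (p 2)\<^sup>2 + real (m + 3) * real (m + 2) / 2 * (p (m + 3))\<^sup>2 + real (m + 3) * (p (m + 4))\<^sup>2 + (p (m + 5))\<^sup>2"
    (is "_ = ?X")
  proof -
    have "(\<Sum>k = 0..m + 3. real ((m + 3) choose k) * (p (k + 2))\<^sup>2) =
        (\<Sum>k\<in>{0, m + 1, m + 2, m + 3}. real ((m + 3) choose k) * (p (k + 2))\<^sup>2)"
      using assms by (intro sum.mono_neutral_right) auto
    also have "\<dots> = ?X"
      by (simp add: real_choose_Suc_Suc_self eval_nat_numeral del: binomial_Suc_Suc)
    finally show ?thesis .
  qed
  have 3: "(\<Sum>k = 0..m + 3. real ((m + 3) choose k) * (p (k + 1) * p (m + 5 - (k + 1)))) =
      2 * p 1 * p (m + 4) + 2 * real (m + 3) * p 2 * p (m + 3)"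
    (is "_ = ?X")
  proof -
    have "(\<Sum>k = 0..m + 3. real ((m + 3) choose k) * (p (k + 1) * p (m + 5 - (k + 1)))) =
        (\<Sum>k\<in>{0, 1, m + 2, m + 3}. real ((m + 3) choose k) * (p (k + 1) * p (m + 5 - (k + 1))))"
      using assms by (intro sum.mono_neutral_right) auto
    also have "\<dots> = ?X"
      by (simp add: real_choose_Suc_Suc_self eval_nat_numeral del: binomial_Suc_Suc)
    finally show ?thesis .
  qed
  have "psi (m + 5) p = (1 / 2 ^ (m + 4) * (\<Sum>k = 0..m + 4. real ((m + 4) choose k) * p (k + 1)))\<^sup>2
      - 1 / 2 ^ (m + 4) * ((\<Sum>k = 0..m + 3. real ((m + 3) choose k) * (p (k + 2))\<^sup>2)
        + (\<Sum>k = 0..m + 3. real ((m + 3) choose k) * (p (k + 1) * p (m + 5 - (k + 1)))))"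
  proof -
    have "m + 5 - 1 = m + 4" "m + 5 - 2 = m + 3" by simp_all
    then show ?thesis unfolding psi_def by (simp only: distrib_left sum.distrib)
  qed
  then show ?thesis unfolding 1 2 3 by (simp add: add.assoc)
qed

text \<open>Here \<open>n = m + 7\<close>, and the index 3 joins the support. Its partner in the
  product term is \<open>n - 3 = m + 4\<close>, where \<open>p\<close> vanishes, so 3 contributes
  only to the mean and to the squares.\<close>

lemma psi_support_6:
  assumes "\<forall>k \<in> {4..m + 4}. p k = 0"
  shows "psi (m + 7) p =
    ((p 1 + real (m + 6) * p 2 + real (m + 6) * real (m + 5) / 2 * (p 3 + p (m + 5)) + real (m + 6) * p (m + 6) + p (m + 7)) / 2 ^ (m + 6))\<^sup>2
    - ((p 2)\<^sup>2 + real (m + 5) * (p 3)\<^sup>2 + real (m + 5) * real (m + 4) / 2 * (p (m + 5))\<^sup>2 + real (m + 5) * (p (m + 6))\<^sup>2 + (p (m + 7))\<^sup>2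
       + 2 * p 1 * p (m + 6) + 2 * real (m + 5) * p 2 * p (m + 5)) / 2 ^ (m + 6)"
proof -
  have 1: "(\<Sum>k = 0..m + 6. real ((m + 6) choose k) * p (k + 1)) =
      p 1 + real (m + 6) * p 2 + real (m + 6) * real (m + 5) / 2 * (p 3 + p (m + 5)) + real (m + 6) * p (m + 6) + p (m + 7)"
    (is "_ = ?X")
  proof -
    have "(\<Sum>k = 0..m + 6. real ((m + 6) choose k) * p (k + 1)) =
        (\<Sum>k\<in>{0, 1, 2, m + 4, m + 5, m + 6}. real ((m + 6) choose k) * p (k + 1))"
      using assms by (intro sum.mono_neutral_right) auto
    also have "\<dots> = ?X"
      by (simp add: real_choose_Suc_Suc_self real_choose_Suc_Suc_2 eval_nat_numeral distrib_left del: binomial_Suc_Suc)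
    finally show ?thesis .
  qed
  have 2: "(\<Sum>k = 0..m + 5. real ((m + 5) choose k) * (p (k + 2))\<^sup>2) =
      (p 2)\<^sup>2 + real (m + 5) * (p 3)\<^sup>2 + real (m + 5) * real (m + 4) / 2 * (p (m + 5))\<^sup>2 + real (m + 5) * (p (m + 6))\<^sup>2 + (p (m + 7))\<^sup>2"
    (is "_ = ?X")
  proof -
    have "(\<Sum>k = 0..m + 5. real ((m + 5) choose k) * (p (k + 2))\<^sup>2) =
        (\<Sum>k\<in>{0, 1, m + 3, m + 4, m + 5}. real ((m + 5) choose k) * (p (k + 2))\<^sup>2)"
      using assms by (intro sum.mono_neutral_right) auto
    also have "\<dots> = ?X"
      by (simp add: real_choose_Suc_Suc_self eval_nat_numeral del: binomial_Suc_Suc)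
    finally show ?thesis .
  qed
  have 3: "(\<Sum>k = 0..m + 5. real ((m + 5) choose k) * (p (k + 1) * p (m + 7 - (k + 1)))) =
      2 * p 1 * p (m + 6) + 2 * real (m + 5) * p 2 * p (m + 5)"
    (is "_ = ?X")
  proof -
    have "p (k + 1) * p (m + 7 - (k + 1)) = 0" if "k \<in> {0..m + 5} - {0, 1, m + 4, m + 5}" for k
      using assms[rule_format, of "k + 1"] assms[rule_format, of "m + 7 - (k + 1)"] that by (cases "k = 2") auto
    then have "(\<Sum>k = 0..m + 5. real ((m + 5) choose k) * (p (k + 1) * p (m + 7 - (k + 1)))) =
        (\<Sum>k\<in>{0, 1, m + 4, m + 5}. real ((m + 5) choose k) * (p (k + 1) * p (m + 7 - (k + 1))))"
      by (intro sum.mono_neutral_right) auto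
    also have "\<dots> = ?X"
      by (simp add: real_choose_Suc_Suc_self eval_nat_numeral del: binomial_Suc_Suc)
    finally show ?thesis .
  qed
  have "psi (m + 7) p = (1 / 2 ^ (m + 6) * (\<Sum>k = 0..m + 6. real ((m + 6) choose k) * p (k + 1)))\<^sup>2
      - 1 / 2 ^ (m + 6) * ((\<Sum>k = 0..m + 5. real ((m + 5) choose k) * (p (k + 2))\<^sup>2)
        + (\<Sum>k = 0..m + 5. real ((m + 5) choose k) * (p (k + 1) * p (m + 7 - (k + 1)))))"
  proof -
    have "m + 7 - 1 = m + 6" "m + 7 - 2 = m + 5" by simp_all
    then show ?thesis unfolding psi_def by (simp only: distrib_left sum.distrib)
  qed
  then show ?thesis unfolding 1 2 3 by (simp add: add.assoc)
qed

text \<open>One homogeneous equation in the two unknowns \<alpha> and \<beta> has a nontrivial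
  solution.\<close>

lemma plane_meets_hyperplane:
  fixes r :: "real vec"
  assumes "r \<in> carrier_vec n"
  obtains \<alpha> \<beta> where "\<alpha> \<noteq> 0 \<or> \<beta> \<noteq> 0" "r \<bullet> vec n (\<lambda>i. \<alpha> * f i + \<beta> * g i) = 0"
proof -
  have lin: "r \<bullet> vec n (\<lambda>i. \<alpha> * f i + \<beta> * g i) = \<alpha> * (r \<bullet> vec n f) + \<beta> * (r \<bullet> vec n g)" for \<alpha> \<beta>
    by (simp add: scalar_prod_def sum.distrib sum_distrib_left algebra_simps)
  show thesis
  proof (cases "r \<bullet> vec n f = 0")
    case True
    then show thesis using that[of 1 0] lin[of 1 0] by simp
  next
    case False
    then show thesis
      using that[of "r \<bullet> vec n g" "- (r \<bullet> vec n f)"] lin[of "r \<bullet> vec n g" "- (r \<bullet> vec n f)"] by simp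
  qed
qed

lemma add_mult_squares_pos:
  fixes a b x y :: real
  assumes "a > 0" "b > 0" "x \<noteq> 0 \<or> y \<noteq> 0"
  shows "a * x\<^sup>2 + b * y\<^sup>2 > 0"
proof (cases "x = 0")
  case False
  with assms have "a * x\<^sup>2 > 0" "b * y\<^sup>2 \<ge> 0" by simp_all
  then show ?thesis by linarith
qed (use assms in simp)

lemma num_pos_eigenvalues_Hess_ge_2:
  assumes "n \<ge> 5" shows "num_pos_eigenvalues (Hess n) \<ge> 2"
proof (rule ccontr)
  assume "\<not> num_pos_eigenvalues (Hess n) \<ge> 2"
  then have "num_pos_eigenvalues (Hess n) \<le> 1" by simp
  then obtain r where r: "r \<in> carrier_vec n"
    "\<And>x. x \<in> carrier_vec n \<Longrightarrow> r \<bullet> x = 0 \<Longrightarrow> x \<bullet> (Hess n *\<^sub>v x) \<le> 0"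
    using nonpos_on_hyperplane_if_num_pos_eigenvalues_le_1[OF Hess_carrier Hess_symmetric] by blast
  obtain m where n: "n = m + 5" using assms by (metis add.commute le_Suc_ex)
  \<comment> \<open>\<open>u\<close> and \<open>v\<close> live on the coupled pairs 1,
    \<open>n - 1\<close> and 2, \<open>n - 2\<close>. Opposite signs make the cross terms outweigh
    the squares, and the disjoint pairs leave no mixed term in \<alpha> and \<beta>.\<close>
  define u :: "nat \<Rightarrow> real" where "u k = (if k = 1 then - real (m + 5) else if k = m + 4 then 1 else 0)" for k
  define v :: "nat \<Rightarrow> real" where "v k = (if k = 2 then - real (m + 3) else if k = m + 3 then 1 else 0)" for k
  obtain \<alpha> \<beta> where nz: "\<alpha> \<noteq> 0 \<or> \<beta> \<noteq> 0"
    and orth: "r \<bullet> vec n (\<lambda>i. \<alpha> * u (Suc i) + \<beta> * v (Suc i)) = 0"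
    by (rule plane_meets_hyperplane[OF r(1), of "\<lambda>i. u (Suc i)" "\<lambda>i. v (Suc i)"])
  define p where "p k = \<alpha> * u k + \<beta> * v k" for k
  have "psi n p \<le> 0"
    using r(2)[OF _ orth] Hess_quadratic_form[of n p] assms by (simp add: p_def)
  moreover have p: "p 1 = - \<alpha> * real (m + 5)" "p 2 = - \<beta> * real (m + 3)" "p (m + 3) = \<beta>" "p (m + 4) = \<alpha>" "p (m + 5) = 0"
    by (simp_all add: p_def u_def v_def algebra_simps)
  have "psi n p > 0"
  proof -
    \<comment> \<open>Up to a positive factor \<open>?Q\<close> is what \<open>psi\<close> subtracts
      from the square of the mean, so its negativity suffices.\<close>
    let ?Q = "(p 2)\<^sup>2 + real (m + 3) * real (m + 2) / 2 * (p (m + 3))\<^sup>2 + real (m + 3) * (p (m + 4))\<^sup>2 + (p (m + 5))\<^sup>2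
       + 2 * p 1 * p (m + 4) + 2 * real (m + 3) * p 2 * p (m + 3)"
    have "?Q = - ((real m + 7) * \<alpha>\<^sup>2 + (real m + 3) * (real m + 4) / 2 * \<beta>\<^sup>2)"
      unfolding p by (simp add: field_simps power2_eq_square)
    also have "\<dots> < 0"
      using add_mult_squares_pos[OF _ _ nz, of "real m + 7" "(real m + 3) * (real m + 4) / 2"] by simp
    finally have Q: "?Q < 0" .
    have supp: "\<forall>k \<in> {3..m + 2}. p k = 0"
      by (auto simp: p_def u_def v_def)
    have "?Q / 2 ^ (m + 4) < 0" by (rule divide_neg_pos[OF Q]) simp
    then show ?thesis
      unfolding n psi_support_5[of m p, OF supp]
      by (smt (verit) zero_le_power2)
  qed
  ultimately show False by simp
qed

lemma num_neg_eigenvalues_Hess_ge_2: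
  assumes "n \<ge> 5" shows "num_neg_eigenvalues (Hess n) \<ge> 2"
proof (rule ccontr)
  assume "\<not> num_neg_eigenvalues (Hess n) \<ge> 2"
  then have "num_neg_eigenvalues (Hess n) \<le> 1" by simp
  then obtain r where r: "r \<in> carrier_vec n"
    "\<And>x. x \<in> carrier_vec n \<Longrightarrow> r \<bullet> x = 0 \<Longrightarrow> x \<bullet> (Hess n *\<^sub>v x) \<ge> 0"
    using nonneg_on_hyperplane_if_num_neg_eigenvalues_le_1[OF Hess_carrier Hess_symmetric] by blast
  obtain m where n: "n = m + 5" using assms by (metis add.commute le_Suc_ex)
  \<comment> \<open>The entry at \<open>n\<close> cancels the mean, since the indices 2 and
    \<open>n - 1\<close> have weight \<open>n - 1\<close> there and \<open>n\<close> has weight 1.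
    No two support indices are coupled, so \<open>psi\<close> is minus a sum of squares.\<close>
  define u :: "nat \<Rightarrow> real" where "u k = (if k = 2 then 1 else if k = m + 5 then - real (m + 4) else 0)" for k
  define v :: "nat \<Rightarrow> real" where "v k = (if k = m + 4 then 1 else if k = m + 5 then - real (m + 4) else 0)" for k
  obtain \<alpha> \<beta> where nz: "\<alpha> \<noteq> 0 \<or> \<beta> \<noteq> 0"
    and orth: "r \<bullet> vec n (\<lambda>i. \<alpha> * u (Suc i) + \<beta> * v (Suc i)) = 0"
    by (rule plane_meets_hyperplane[OF r(1), of "\<lambda>i. u (Suc i)" "\<lambda>i. v (Suc i)"])
  define p where "p k = \<alpha> * u k + \<beta> * v k" for k
  have "psi n p \<ge> 0"
    using r(2)[OF _ orth] Hess_quadratic_form[of n p] assms by (simp add: p_def)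
  moreover have p: "p 1 = 0" "p 2 = \<alpha>" "p (m + 3) = 0" "p (m + 4) = \<beta>" "p (m + 5) = - (\<alpha> + \<beta>) * real (m + 4)"
    by (simp_all add: p_def u_def v_def algebra_simps)
  have "psi n p < 0"
  proof -
    have supp: "\<forall>k \<in> {3..m + 2}. p k = 0"
      by (auto simp: p_def u_def v_def)
    have M: "p 1 + real (m + 4) * p 2 + real (m + 4) * real (m + 3) / 2 * p (m + 3) + real (m + 4) * p (m + 4) + p (m + 5) = 0"
      unfolding p by (simp add: algebra_simps)
    have "psi n p = - (\<alpha>\<^sup>2 + (real m + 3) * \<beta>\<^sup>2 + ((\<alpha> + \<beta>) * real (m + 4))\<^sup>2) / 2 ^ (m + 4)"
      unfolding n psi_support_5[of m p, OF supp] M unfolding p by (simp add: power2_eq_square field_simps)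
    moreover have "\<alpha>\<^sup>2 + (real m + 3) * \<beta>\<^sup>2 + ((\<alpha> + \<beta>) * real (m + 4))\<^sup>2 > 0"
      using add_mult_squares_pos[OF _ _ nz, of 1 "real m + 3"] by (simp add: add_pos_nonneg)
    ultimately show ?thesis by (simp add: divide_neg_pos)
  qed
  ultimately show False by simp
qed

section \<open>Influence and palindromes\<close>

text \<open>Flipping \<open>i\<close> itself replaces the coordinates that agree with
  \<open>i\<close> by those that disagreed, together with \<open>i\<close>.\<close>

lemma card_agreeing_flip:
  assumes x: "x \<in> {1..n} \<rightarrow>\<^sub>E {0, 1}" and i: "i \<in> {1..n}"
  shows "card {l \<in> {1..n}. flip i x l = flip i x i} = n + 1 - card {l \<in> {1..n}. x l = x i}"
proof -
  let ?K = "{l \<in> {1..n}. x l = x i}"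
  have bin: "x l = 0 \<or> x l = 1" if "l \<in> {1..n}" for l using x that by auto
  have "flip i x l = flip i x i \<longleftrightarrow> l = i \<or> x l \<noteq> x i" if "l \<in> {1..n}" for l
    using bin[OF that] bin[OF i] by (auto simp: flip_def)
  with i have A: "{l \<in> {1..n}. flip i x l = flip i x i} = insert i ({1..n} - ?K)" by blast
  have B: "card (insert i ({1..n} - ?K)) = Suc (card ({1..n} - ?K))"
    using i by (intro card_insert_disjoint) auto
  have C: "card ({1..n} - ?K) = card {1..n} - card ?K"
    by (intro card_Diff_subset) auto
  have "card ?K \<le> card {1..n}" by (rule card_mono) auto
  then have le: "card ?K \<le> n" by (simp only: card_atLeastAtMost diff_Suc_1)
  have "Suc (n - c) = n + 1 - c" if "c \<le> n" for c using that by linarith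
  from this[OF le] show ?thesis
    unfolding A B C card_atLeastAtMost diff_Suc_1 .
qed

text \<open>Flipping the own coordinate moves the count from \<open>k\<close> to
  \<open>n + 1 - k\<close>, so the case \<open>i = j\<close> says that \<open>p\<close> is not a
  palindrome. Flipping another coordinate changes the count by one, so the other cases only need two
  different neighbouring values, which every nonpalindrome has.\<close>

lemma Inf_set_eq_nonpalindromes:
  assumes n: "n \<ge> 1"
  shows "Inf_set n = {p \<in> {1..n} \<rightarrow>\<^sub>E {0..1}. \<exists>k \<in> {1..n}. p k \<noteq> p (n + 1 - k)}"
proof (intro equalityI subsetI)
  fix p :: "nat \<Rightarrow> real" assume p: "p \<in> Inf_set n"
  have "\<exists>k \<in> {1..n}. p k \<noteq> p (n + 1 - k)"
  proof -
    obtain x where x: "x \<in> {1..n} \<rightarrow>\<^sub>E {0, 1}" "pi_val n p 1 x \<noteq> pi_val n p 1 (flip 1 x)"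
    proof -
      have "1 \<in> {1..n}" using n by simp
      with p show ?thesis using that unfolding Inf_set_def by blast
    qed
    define k where "k = card {l \<in> {1..n}. x l = x 1}"
    have "k \<le> card {1..n}" unfolding k_def by (rule card_mono) auto
    moreover have "k > 0" using n by (auto simp: k_def card_gt_0_iff)
    moreover have "p k \<noteq> p (n + 1 - k)"
      using x(2) card_agreeing_flip[OF x(1), of 1] n by (simp add: pi_val_def k_def)
    ultimately show ?thesis by (intro bexI[of _ k]) auto
  qed
  then show "p \<in> {p \<in> {1..n} \<rightarrow>\<^sub>E {0..1}. \<exists>k \<in> {1..n}. p k \<noteq> p (n + 1 - k)}"
    using p by (simp add: Inf_set_def)
next
  fix p :: "nat \<Rightarrow> real" assume "p \<in> {p \<in> {1..n} \<rightarrow>\<^sub>E {0..1}. \<exists>k \<in> {1..n}. p k \<noteq> p (n + 1 - k)}"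
  then obtain k where cube: "p \<in> {1..n} \<rightarrow>\<^sub>E {0..1}" and k: "k \<in> {1..n}" "p k \<noteq> p (n + 1 - k)" by blast
  have "\<exists>m \<in> {1..<n}. p m \<noteq> p (Suc m)"
  proof (rule ccontr)
    assume "\<not> (\<exists>m \<in> {1..<n}. p m \<noteq> p (Suc m))"
    then have step: "p (Suc l) = p l" if "1 \<le> l" "l < n" for l
      using that by force
    have "Suc l \<le> n \<longrightarrow> p (Suc l) = p 1" for l
    proof (induction l)
      case (Suc l)
      show ?case using step[of "Suc l"] Suc.IH by simp
    qed simp
    then have const: "p l = p 1" if "l \<in> {1..n}" for l
      using that by (metis Suc_le_D atLeastAtMost_iff One_nat_def)
    have "n + 1 - k \<in> {1..n}" using k by auto
    then show False using k const by metis
  qed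
  then obtain m where m: "1 \<le> m" "m < n" "p m \<noteq> p (Suc m)" by auto
  have "\<exists>x \<in> {1..n} \<rightarrow>\<^sub>E {0, 1}. pi_val n p i x \<noteq> pi_val n p i (flip j x)"
    if ij: "i \<in> {1..n}" "j \<in> {1..n}" for i j
  proof -
    \<comment> \<open>\<open>X T\<close> is 0 exactly on \<open>T\<close>, so for \<open>i\<close>
      in \<open>T\<close> the coordinates agreeing with \<open>i\<close> form
      \<open>T\<close>.\<close>
    define X where "X T = (\<lambda>l. if l \<in> {1..n} then if l \<in> T then 0 else 1 else undefined :: nat)" for T
    have X: "X T \<in> {1..n} \<rightarrow>\<^sub>E {0, 1}" for T by (auto simp: X_def)
    have agree: "{l \<in> {1..n}. X T l = X T i} = T" if "T \<subseteq> {1..n}" "i \<in> T" for T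
      using that ij by (auto simp: X_def)
    have subset: "\<exists>T \<subseteq> {1..n} - {j}. i \<in> T \<and> card T = c"
      if "i \<noteq> j" "1 \<le> c" "c < n" for c
    proof -
      have "c - 1 \<le> card ({1..n} - {i, j})" using that ij by auto
      then obtain T where "T \<subseteq> {1..n} - {i, j}" "card T = c - 1" "finite T"
        by (rule obtain_subset_with_card_n)
      then show ?thesis
        using that ij by (intro exI[of _ "insert i T"]) (auto simp: card_insert_if)
    qed
    show ?thesis
    proof (cases "i = j")
      case True
      have "k - 1 \<le> card ({1..n} - {i})" using k ij by auto
      then obtain T where T: "T \<subseteq> {1..n} - {i}" "card T = k - 1" "finite T"
        by (rule obtain_subset_with_card_n)
      have *: "card {l \<in> {1..n}. X (insert i T) l = X (insert i T) i} = k"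
      proof -
        have "{l \<in> {1..n}. X (insert i T) l = X (insert i T) i} = insert i T"
          using T(1) ij by (intro agree) auto
        moreover have "card (insert i T) = Suc (card T)"
          using T by (intro card_insert_disjoint) auto
        ultimately show ?thesis using T(2) k by simp
      qed
      then have "pi_val n p i (X (insert i T)) = p k" by (simp add: pi_val_def)
      moreover have "pi_val n p i (flip i (X (insert i T))) = p (n + 1 - k)"
        using card_agreeing_flip[OF X ij(1), of "insert i T"] * by (simp add: pi_val_def)
      ultimately show ?thesis using k X True by metis
    next
      case False
      \<comment> \<open>As \<open>j\<close> lies outside \<open>T\<close>, flipping it enlarges the
        class of \<open>i\<close> from \<open>m\<close> to \<open>m + 1\<close> elements.\<close>
      obtain T where T: "T \<subseteq> {1..n} - {j}" "i \<in> T" "card T = m"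
        using subset[OF False m(1,2)] by blast
      have fin: "finite T" using T(1) by (rule finite_subset) simp
      have "{l \<in> {1..n}. X T l = X T i} = T" using T by (intro agree) auto
      then have "pi_val n p i (X T) = p m" using T by (simp add: pi_val_def)
      moreover have "{l \<in> {1..n}. flip j (X T) l = flip j (X T) i} = insert j T"
        using T ij False by (auto simp: flip_def X_def split: if_splits)
      then have "pi_val n p i (flip j (X T)) = p (Suc m)"
        using T fin by (auto simp: pi_val_def card_insert_if)
      ultimately show ?thesis using m X by metis
    qed
  qed
  then show "p \<in> Inf_set n" using cube by (simp add: Inf_set_def)
qed

lemma GST_iff:
  assumes "n \<ge> 1"
  shows "p \<in> GST n \<longleftrightarrow> p \<in> {1..n} \<rightarrow>\<^sub>E {0..1} \<and> psi n p = 0 \<and> (\<exists>k \<in> {1..n}. p k \<noteq> p (n + 1 - k))"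
  using assms by (auto simp: GST_def Ind_def Inf_set_eq_nonpalindromes)

lemma GST_subset_topspace: "GST n \<subseteq> topspace (powertop_real {1..n})"
  by (auto simp: GST_def Ind_def PiE_def)

section \<open>Disconnectedness for three and four variables\<close>

text \<open>By the intermediate value property, the image of a connected set would contain
  0.\<close>

lemma not_connected_GST_if_sign_change:
  assumes f: "continuous_map (powertop_real {1..n}) euclideanreal f"
    and nz: "\<And>p. p \<in> GST n \<Longrightarrow> f p \<noteq> 0"
    and p: "p \<in> GST n" "f p < 0" and q: "q \<in> GST n" "f q > 0"
  shows "\<not> connected_space (GST_space n)"
proof
  assume "connected_space (GST_space n)"
  then have "connectedin (powertop_real {1..n}) (GST n)"
    using GST_subset_topspace by (simp add: connectedin_def GST_space_def)
  from connectedin_continuous_map_image[OF f this]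
  have "{f p..f q} \<subseteq> f ` GST n" using p q by (intro connected_contains_Icc) auto
  then show False using nz p q by (auto simp: subset_iff image_iff) (metis less_eq_real_def)
qed

text \<open>The form splits into two linear factors. The factor \<open>p 1 - p 3\<close> vanishes
  exactly on the palindromes, and it takes both signs on the zero plane of the other factor.\<close>

lemma not_connected_GST_3: "\<not> connected_space (GST_space 3)"
proof (rule not_connected_GST_if_sign_change)
  have psi: "psi 3 p = (p 1 - p 3) * (p 1 - 4 * p 2 + 3 * p 3) / 16" for p
    by (simp add: psi_def eval_nat_numeral field_simps power2_eq_square)
  \<comment> \<open>These points lie on the plane \<open>p 1 - 4 * p 2 + 3 * p 3 = 0\<close>, on
    opposite sides of the centre for opposite \<open>c\<close>.\<close>
  define P :: "real \<Rightarrow> nat \<Rightarrow> real" where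
    "P c = (\<lambda>k \<in> {1..3}. if k = 1 then 1 / 2 - 3 * c else if k = 2 then 1 / 2 else 1 / 2 + c)" for c
  have P: "P c \<in> GST 3" if "\<bar>c\<bar> = 1 / 8" for c
  proof -
    have "P c \<in> {1..3} \<rightarrow>\<^sub>E {0..1}" using that by (auto simp: P_def)
    moreover have "psi 3 (P c) = 0" by (simp add: psi P_def)
    moreover have "P c 1 \<noteq> P c (3 + 1 - 1)" using that by (auto simp: P_def)
    ultimately show ?thesis by (subst GST_iff) (auto intro!: bexI[of _ "1::nat"])
  qed
  show "continuous_map (powertop_real {1..3 :: nat}) euclideanreal (\<lambda>p. p 1 - p 3)"
    by (intro continuous_intros) auto
  show "p 1 - p 3 \<noteq> 0" if p: "p \<in> GST 3" for p
  proof
    assume "p 1 - p 3 = 0"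
    moreover obtain k where k: "k \<in> {1..3}" "p k \<noteq> p (3 + 1 - k)" using p by (auto simp: GST_iff)
    have "k = 1 \<or> k = 2 \<or> k = 3" using k(1) unfolding atLeastAtMost_iff by linarith
    ultimately show False using k(2) by auto
  qed
  show "P (1 / 8) \<in> GST 3" "P (- 1 / 8) \<in> GST 3" by (auto intro: P)
  show "P (1 / 8) 1 - P (1 / 8) 3 < 0" "P (- 1 / 8) 1 - P (- 1 / 8) 3 > 0"
    by (auto simp: P_def)
qed

text \<open>The form has a single positive square \<open>l\<close>. Where \<open>psi\<close> and
  \<open>l\<close> both vanish, so do the two negative squares, and then \<open>p\<close> is
  constant. Hence \<open>l\<close> separates the two halves of the cone.\<close>

lemma not_connected_GST_4: "\<not> connected_space (GST_space 4)"
proof (rule not_connected_GST_if_sign_change)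
  define l :: "(nat \<Rightarrow> real) \<Rightarrow> real" where "l p = 5 * p 3 - p 1 - 3 * p 2 - p 4" for p
  have psi: "64 * psi 4 p = (l p)\<^sup>2 - 24 * (p 2 - p 3)\<^sup>2 - 8 * (p 4 - p 3)\<^sup>2" for p
    by (simp add: psi_def l_def eval_nat_numeral field_simps power2_eq_square)
  \<comment> \<open>With \<open>p 2 = p 3\<close> the equation reduces to \<open>l\<close> squared
    being 8 times the square of \<open>p 4 - p 3\<close>. Here \<open>l\<close> is
    \<open>8 * c\<close> and \<open>p 4 - p 3\<close> is \<open>2 * sqrt 2 * c\<close>. The size
    1/20 of \<open>c\<close> keeps the point in the cube, by
    \<open>sqrt 2 \<le> 3 / 2\<close>.\<close>
  define P :: "real \<Rightarrow> nat \<Rightarrow> real" where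
    "P c = (\<lambda>k \<in> {1..4}. if k = 1 then 1 / 2 - (7 + 2 * sqrt 2) * c else if k = 4 then 1 / 2 + (1 + 2 * sqrt 2) * c else 1 / 2 + c)" for c
  have sqrt2: "sqrt 2 \<le> 3 / 2" "sqrt 2 \<ge> 0"
    by (rule real_le_lsqrt) (simp_all add: power2_eq_square)
  have P: "P c \<in> GST 4" if "\<bar>c\<bar> = 1 / 20" for c
  proof -
    have "\<bar>(7 + 2 * sqrt 2) * c\<bar> \<le> 1 / 2" "\<bar>(1 + 2 * sqrt 2) * c\<bar> \<le> 1 / 2" "\<bar>c\<bar> \<le> 1 / 2"
      using sqrt2 by (simp_all add: abs_mult that)
    then have "P c \<in> {1..4} \<rightarrow>\<^sub>E {0..1}"
      unfolding P_def abs_le_iff by (intro restrict_PiE_iff[THEN iffD2] ballI) auto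
    moreover have "64 * psi 4 (P c) = 0" unfolding psi by (simp add: l_def P_def algebra_simps power2_eq_square)
    moreover have "8 + 4 * sqrt 2 > 0" by (simp add: add_pos_nonneg)
    then have "(8 + 4 * sqrt 2) * c \<noteq> 0" using that by auto
    then have "P c 1 \<noteq> P c (4 + 1 - 1)" by (simp add: P_def algebra_simps)
    ultimately show ?thesis by (subst GST_iff) (auto intro!: bexI[of _ "1::nat"])
  qed
  show "continuous_map (powertop_real {1..4}) euclideanreal l"
    unfolding l_def by (intro continuous_intros) auto
  show "l p \<noteq> 0" if p: "p \<in> GST 4" for p
  proof
    assume l: "l p = 0"
    have "24 * (p 2 - p 3)\<^sup>2 + 8 * (p 4 - p 3)\<^sup>2 = 0"
      using psi[of p] p l by (simp add: GST_iff)
    then have "p 2 = p 3" "p 4 = p 3"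
      by (smt (verit) zero_le_power2 power2_eq_iff zero_eq_power2)+
    moreover from this have "p 1 = p 3" using l by (simp add: l_def)
    moreover obtain k where k: "k \<in> {1..4}" "p k \<noteq> p (4 + 1 - k)" using p by (auto simp: GST_iff)
    have "k = 1 \<or> k = 2 \<or> k = 3 \<or> k = 4" using k(1) unfolding atLeastAtMost_iff by linarith
    ultimately show False using k(2) by auto
  qed
  show "P (- 1 / 20) \<in> GST 4" "P (1 / 20) \<in> GST 4" by (auto intro: P)
  show "l (P (- 1 / 20)) < 0" "l (P (1 / 20)) > 0"
    using sqrt2 by (auto simp: l_def P_def algebra_simps)
qed

section \<open>Connectedness\<close>

lemma continuous_map_restrict_powertop_real:
  assumes "\<And>k. k \<in> I \<Longrightarrow> continuous_on UNIV (\<lambda>t. f t k)"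
  shows "continuous_map euclideanreal (powertop_real I) (\<lambda>t. \<lambda>k \<in> I. f t k)"
  using assms by (auto simp: continuous_map_componentwise)

lemma exists_unit_vector_orthogonal:
  fixes x y :: real
  obtains \<theta> where "cos \<theta> * x + sin \<theta> * y = 0"
proof (cases "x = 0 \<and> y = 0")
  case False
  define r where "r = sqrt (x\<^sup>2 + y\<^sup>2)"
  have "x\<^sup>2 + y\<^sup>2 > 0" using False by (metis sum_power2_gt_zero_iff)
  then have r: "r > 0" "r\<^sup>2 = x\<^sup>2 + y\<^sup>2" by (auto simp: r_def)
  have "(y / r)\<^sup>2 + (- x / r)\<^sup>2 = 1"
  proof -
    have "(y / r)\<^sup>2 + (- x / r)\<^sup>2 = (x\<^sup>2 + y\<^sup>2) / r\<^sup>2"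
      by (simp add: power_divide add_divide_distrib)
    then show ?thesis using r by (metis divide_self less_irrefl power_not_zero)
  qed
  then obtain \<theta> where "y / r = cos \<theta>" "- x / r = sin \<theta>"
    using sincos_total_2pi by metis
  then have "cos \<theta> * x + sin \<theta> * y = 0" by (metis add.right_inverse mult.commute minus_divide_left mult_minus_left times_divide_eq_left)
  then show thesis by (rule that)
qed (use that in auto)

text \<open>
  If the isotropic vectors \<open>a\<close>, \<open>b\<close> span a totally isotropic plane that meets the palindromes only
  in \<open>0\<close>, then a small circle in this plane, moved to the centre of the cube, lies in \<^term>\<open>GST n\<close>.
  A point \<open>p\<close> is orthogonal to some point \<open>w\<close> of the circle, so the segments from \<open>p\<close> to \<open>w\<close> and to
  the antipode of \<open>w\<close> stay in the zero set, and at most one of them meets the palindromes.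
\<close>
lemma connected_GST_if_isotropic_plane:
  assumes n: "n \<ge> 2" and iso: "psi n a = 0" "psi n b = 0" "polar n a b = 0"
    and indep: "\<And>\<alpha> \<beta>. \<alpha> \<noteq> 0 \<or> \<beta> \<noteq> 0 \<Longrightarrow>
      \<exists>k \<in> {1..n}. \<alpha> * a k + \<beta> * b k \<noteq> \<alpha> * a (n + 1 - k) + \<beta> * b (n + 1 - k)"
  shows "connected_space (GST_space n)"
proof -
  let ?X = "powertop_real {1..n}"
  \<comment> \<open>Dividing by \<open>B\<close> shrinks the circle so that it fits into the cube
    around the centre; the summand 1 keeps \<open>B\<close> positive.\<close>
  define B where "B = 4 * (1 + (\<Sum>k = 1..n. \<bar>a k\<bar>) + (\<Sum>k = 1..n. \<bar>b k\<bar>))"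
  have B: "B > 0" by (simp add: B_def add_pos_nonneg sum_nonneg)
  define w where "w \<theta> k = cos \<theta> / B * a k + sin \<theta> / B * b k" for \<theta> k
  have w_bound: "\<bar>w \<theta> k\<bar> \<le> 1 / 2" if k: "k \<in> {1..n}" for \<theta> k
  proof -
    have "\<bar>a k\<bar> \<le> (\<Sum>k = 1..n. \<bar>a k\<bar>)" "\<bar>b k\<bar> \<le> (\<Sum>k = 1..n. \<bar>b k\<bar>)"
      using k by (auto intro: member_le_sum)
    then have "\<bar>a k\<bar> + \<bar>b k\<bar> \<le> B / 4" by (simp add: B_def)
    moreover have "\<bar>cos \<theta> * a k + sin \<theta> * b k\<bar> \<le> \<bar>a k\<bar> + \<bar>b k\<bar>"
    proof -
      have "\<bar>cos \<theta> * a k\<bar> \<le> \<bar>a k\<bar>" "\<bar>sin \<theta> * b k\<bar> \<le> \<bar>b k\<bar>"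
        by (auto simp: abs_mult intro: mult_left_le_one_le)
      then show ?thesis by linarith
    qed
    ultimately have "\<bar>cos \<theta> * a k + sin \<theta> * b k\<bar> \<le> B / 2" using B by linarith
    moreover have "w \<theta> k = (cos \<theta> * a k + sin \<theta> * b k) / B" by (simp add: w_def add_divide_distrib)
    ultimately have "\<bar>w \<theta> k\<bar> = \<bar>cos \<theta> * a k + sin \<theta> * b k\<bar> / B" "\<bar>cos \<theta> * a k + sin \<theta> * b k\<bar> \<le> B / 2"
      using B by (simp_all add: abs_divide)
    then show ?thesis using B by (simp add: pos_divide_le_eq)
  qed
  have psi_w: "psi n (w \<theta>) = 0" for \<theta>
    unfolding w_def psi_lincomb by (simp add: iso)
  have w_nonpal: "\<exists>k \<in> {1..n}. w \<theta> k \<noteq> w \<theta> (n + 1 - k)" for \<theta>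
  proof -
    have "cos \<theta> / B \<noteq> 0 \<or> sin \<theta> / B \<noteq> 0"
      using B sin_cos_squared_add[of \<theta>] by (auto simp: power2_eq_square)
    from indep[OF this] show ?thesis by (simp add: w_def)
  qed
  have w_pi: "w (\<theta> + pi) k = - w \<theta> k" for \<theta> k by (simp add: w_def)
  define c where "c \<theta> = (\<lambda>k \<in> {1..n}. 1 / 2 + w \<theta> k)" for \<theta>
  define C where "C = range c"
  have C_GST: "C \<subseteq> GST n"
  proof -
    have "c \<theta> \<in> GST n" for \<theta>
    proof -
      have "c \<theta> \<in> {1..n} \<rightarrow>\<^sub>E {0..1}"
      proof (rule PiE_I)
        fix k assume k: "k \<in> {1..n}"
        have "0 \<le> 1 / 2 + w \<theta> k" "1 / 2 + w \<theta> k \<le> 1" using w_bound[OF k, of \<theta>] by linarith+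
        then show "c \<theta> k \<in> {0..1}" using k by (simp add: c_def)
      qed (auto simp: c_def)
      moreover have "psi n (c \<theta>) = psi n (\<lambda>k. w \<theta> k + 1 / 2)"
        by (rule psi_cong[OF n]) (auto simp: c_def)
      then have "psi n (c \<theta>) = 0" using n by (simp only: psi_translate psi_w)
      moreover obtain k where "k \<in> {1..n}" "w \<theta> k \<noteq> w \<theta> (n + 1 - k)" using w_nonpal by blast
      then have "\<exists>k \<in> {1..n}. c \<theta> k \<noteq> c \<theta> (n + 1 - k)"
        by (intro bexI[of _ k]) (auto simp: c_def)
      ultimately show ?thesis using n by (simp add: GST_iff)
    qed
    then show ?thesis by (auto simp: C_def)
  qed
  have "continuous_map euclideanreal ?X c"
    unfolding c_def w_def using B by (intro continuous_map_restrict_powertop_real continuous_intros) auto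
  then have C: "connectedin ?X C"
    unfolding C_def by (rule connectedin_continuous_map_image) simp
  have "\<exists>S. connectedin ?X S \<and> p \<in> S \<and> S \<subseteq> GST n \<and> S \<inter> C \<noteq> {}" if p: "p \<in> GST n" for p
  proof -
    have pE: "p \<in> {1..n} \<rightarrow>\<^sub>E {0..1}" and psi_p: "psi n p = 0" and p_nonpal: "\<exists>k \<in> {1..n}. p k \<noteq> p (n + 1 - k)"
      using p n by (auto simp: GST_iff)
    \<comment> \<open>\<open>polar n p\<close> restricted to the plane is a linear form in two
      coordinates, so it vanishes at some point of the circle.\<close>
    obtain \<theta>\<^sub>0 where \<theta>\<^sub>0: "cos \<theta>\<^sub>0 * polar n p a + sin \<theta>\<^sub>0 * polar n p b = 0"
      by (rule exists_unit_vector_orthogonal)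
    have polar_w: "polar n p (w \<theta>\<^sub>0) = 0"
      unfolding w_def polar_lincomb_right using \<theta>\<^sub>0 by (simp flip: add_divide_distrib)
    then have polar_w': "polar n p (w (\<theta>\<^sub>0 + pi)) = 0"
      using polar_lincomb_right[of n p "- 1" "w \<theta>\<^sub>0" 0 "w \<theta>\<^sub>0"] by (simp flip: w_pi)
    \<comment> \<open>The segment is first taken without the shift to the centre: adding
      \<open>t / 2\<close> to all entries changes neither \<open>psi\<close> nor being a
      palindrome.\<close>
    define seg where "seg \<theta> t k = (1 - t) * p k + t * w \<theta> k" for \<theta> t k
    have "(\<forall>t \<in> {0..1}. \<exists>k \<in> {1..n}. seg \<theta>\<^sub>0 t k \<noteq> seg \<theta>\<^sub>0 t (n + 1 - k)) \<or>
        (\<forall>t \<in> {0..1}. \<exists>k \<in> {1..n}. seg (\<theta>\<^sub>0 + pi) t k \<noteq> seg (\<theta>\<^sub>0 + pi) t (n + 1 - k))"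
    proof (rule ccontr)
      assume "\<not> ?thesis"
      then obtain s t where st: "s \<in> {0..1}" "t \<in> {0..1}"
        and s: "\<forall>k \<in> {1..n}. seg \<theta>\<^sub>0 s k = seg \<theta>\<^sub>0 s (n + 1 - k)"
        and t: "\<forall>k \<in> {1..n}. seg (\<theta>\<^sub>0 + pi) t k = seg (\<theta>\<^sub>0 + pi) t (n + 1 - k)" by blast
      \<comment> \<open>If both segments met the palindromes, the antisymmetric parts
        \<open>d\<close> of \<open>p\<close> and \<open>e\<close> of \<open>w\<close> would be
        proportional with both signs at once. Multiplying by \<open>d k\<close> makes this visible
        as contradictory signs of \<open>e k * d k\<close>.\<close>
      define d where "d k = p k - p (n + 1 - k)" for k
      define e where "e k = w \<theta>\<^sub>0 k - w \<theta>\<^sub>0 (n + 1 - k)" for k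
      have s': "(1 - s) * d k + s * e k = 0" if "k \<in> {1..n}" for k
        using s that by (simp add: seg_def d_def e_def algebra_simps)
      have t': "(1 - t) * d k - t * e k = 0" if "k \<in> {1..n}" for k
        using t that unfolding seg_def w_pi d_def e_def by (simp add: algebra_simps)
      obtain k where k: "k \<in> {1..n}" "d k \<noteq> 0" using p_nonpal by (auto simp: d_def)
      obtain l where l: "l \<in> {1..n}" "e l \<noteq> 0" using w_nonpal[of \<theta>\<^sub>0] by (auto simp: e_def)
      \<comment> \<open>At parameter 1 the relation would give \<open>e l = 0\<close>, but no point
        of the circle is a palindrome.\<close>
      have "s \<noteq> 1" "t \<noteq> 1" using s'[OF l(1)] t'[OF l(1)] l(2) by auto
      then have *: "(1 - s) * (d k)\<^sup>2 > 0" "(1 - t) * (d k)\<^sup>2 > 0" using st k by auto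
      have "(1 - s) * d k = - s * e k" "(1 - t) * d k = t * e k"
        using s'[OF k(1)] t'[OF k(1)] by simp_all
      then have "(1 - s) * d k * d k = - s * e k * d k" "(1 - t) * d k * d k = t * e k * d k"
        by simp_all
      then have "(1 - s) * (d k)\<^sup>2 = - (s * (e k * d k))" "(1 - t) * (d k)\<^sup>2 = t * (e k * d k)"
        by (simp_all only: power2_eq_square mult.assoc mult_minus_left)
      with * have "s * (e k * d k) < 0" "t * (e k * d k) > 0" by auto
      then show False using st by (auto simp: zero_less_mult_iff mult_less_0_iff)
    qed
    then obtain \<theta> where seg_nonpal: "\<forall>t \<in> {0..1}. \<exists>k \<in> {1..n}. seg \<theta> t k \<noteq> seg \<theta> t (n + 1 - k)"
      and polar: "polar n p (w \<theta>) = 0" using polar_w polar_w' by blast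
    define \<gamma> where "\<gamma> t = (\<lambda>k \<in> {1..n}. seg \<theta> t k + t / 2)" for t
    have GST: "\<gamma> t \<in> GST n" if t: "t \<in> {0..1}" for t
    proof -
      have "\<gamma> t \<in> {1..n} \<rightarrow>\<^sub>E {0..1}"
      proof (rule PiE_I)
        fix k assume k: "k \<in> {1..n}"
        have "p k \<in> {0..1}" using pE k by auto
        moreover have "1 / 2 + w \<theta> k \<in> {0..1}" using w_bound[OF k, of \<theta>] by (auto simp: abs_le_iff)
        ultimately have "(1 - t) *\<^sub>R p k + t *\<^sub>R (1 / 2 + w \<theta> k) \<in> {0..1}"
          using t by (intro convexD[OF convex_real_interval(5)]) auto
        moreover have "\<gamma> t k = (1 - t) *\<^sub>R p k + t *\<^sub>R (1 / 2 + w \<theta> k)"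
          using k by (simp add: \<gamma>_def seg_def algebra_simps)
        ultimately show "\<gamma> t k \<in> {0..1}" by simp
      qed (auto simp: \<gamma>_def)
      moreover have "psi n (\<gamma> t) = psi n (\<lambda>k. seg \<theta> t k + t / 2)"
        by (rule psi_cong[OF n]) (auto simp: \<gamma>_def)
      then have "psi n (\<gamma> t) = psi n (seg \<theta> t)" using n by (simp only: psi_translate)
      then have "psi n (\<gamma> t) = 0"
        unfolding seg_def psi_lincomb by (simp add: psi_p psi_w polar)
      moreover obtain k where "k \<in> {1..n}" "seg \<theta> t k \<noteq> seg \<theta> t (n + 1 - k)" using seg_nonpal t by blast
      then have "\<exists>k \<in> {1..n}. \<gamma> t k \<noteq> \<gamma> t (n + 1 - k)"
        by (intro bexI[of _ k]) (auto simp: \<gamma>_def)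
      ultimately show ?thesis using n by (simp add: GST_iff)
    qed
    have "\<gamma> ` {0..1} \<subseteq> GST n" using GST by blast
    moreover have "continuous_map euclideanreal ?X \<gamma>"
      unfolding \<gamma>_def seg_def by (intro continuous_map_restrict_powertop_real continuous_intros) auto
    then have "connectedin ?X (\<gamma> ` {0..1})"
      by (rule connectedin_continuous_map_image) simp
    moreover have "\<gamma> 0 = p" using pE by (auto simp: \<gamma>_def seg_def PiE_def extensional_def fun_eq_iff)
    then have "p \<in> \<gamma> ` {0..1}" by force
    moreover have "\<gamma> 1 = c \<theta>" by (auto simp: \<gamma>_def seg_def c_def)
    then have "c \<theta> \<in> \<gamma> ` {0..1}" by (intro image_eqI[of _ _ 1]) simp_all
    then have "\<gamma> ` {0..1} \<inter> C \<noteq> {}" unfolding C_def by blast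
    ultimately show ?thesis by blast
  qed
  then obtain S where S: "\<And>p. p \<in> GST n \<Longrightarrow> connectedin ?X (S p) \<and> p \<in> S p \<and> S p \<subseteq> GST n \<and> S p \<inter> C \<noteq> {}"
    by metis
  \<comment> \<open>Each path is joined with the whole circle, so that all members of the union
    share the point \<open>c 0\<close>.\<close>
  have "connectedin ?X (\<Union>p \<in> GST n. S p \<union> C)"
  proof (rule connectedin_Union)
    show "connectedin ?X T" if "T \<in> (\<lambda>p. S p \<union> C) ` GST n" for T
      using that S C by (auto intro: connectedin_Un)
    have "c 0 \<in> \<Inter> ((\<lambda>p. S p \<union> C) ` GST n)" by (simp add: C_def)
    then show "\<Inter> ((\<lambda>p. S p \<union> C) ` GST n) \<noteq> {}" by blast
  qed
  moreover have "(\<Union>p \<in> GST n. S p \<union> C) = GST n"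
    using S C_GST by blast
  ultimately show ?thesis by (simp add: connectedin_def GST_space_def)
qed

section \<open>An explicit isotropic plane\<close>

lemma connected_GST:
  assumes "n \<ge> 8" shows "connected_space (GST_space n)"
proof -
  obtain m where n: "n = m + 7" and m: "m \<ge> 1"
    using assms that[of "n - 7"] by simp
  define N where "N = real m"
  text \<open>
    The roots \<open>z\<close> and \<open>x\<close> make the vectors \<open>a\<close> and \<open>b\<close> below isotropic; their entries at \<open>1\<close> and at \<open>3\<close>
    make both means vanish.  Then \<open>a\<close> and \<open>b\<close> are orthogonal because the remaining part of the form
    couples only the indices \<open>j\<close> and \<open>n - j\<close>.
  \<close>
  define z where "z = 1 + sqrt (N + 8)"
  define x where "x = (- (N + 7) + sqrt (((N + 7)\<^sup>2 - (N + 7) + 2) / 2)) * (N + 5) / (N + 9)"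
  define s where "s = - 2 * x / (N + 5) - 1"
  have N: "N \<ge> 1" using m by (simp add: N_def)
  have z: "z\<^sup>2 = 2 * z + N + 7" "z > 0"
  proof -
    show "z\<^sup>2 = 2 * z + N + 7" using N by (simp add: z_def power2_eq_square algebra_simps)
    have "sqrt (N + 8) \<ge> 0" using N by simp
    then show "z > 0" by (simp only: z_def)
  qed
  have x: "(N + 9) * x\<^sup>2 + 2 * (N + 7) * (N + 5) * x + (N + 6) * (N + 5)\<^sup>2 / 2 = 0"
  proof -
    define r where "r = sqrt (((N + 7)\<^sup>2 - (N + 7) + 2) / 2)"
    have "((N + 7)\<^sup>2 - (N + 7) + 2) / 2 \<ge> 0" using N by (simp add: power2_eq_square algebra_simps)
    then have r: "r\<^sup>2 = ((N + 7)\<^sup>2 - (N + 7) + 2) / 2" by (simp add: r_def)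
    have y: "(N + 9) * x = (r - (N + 7)) * (N + 5)" using N by (simp add: x_def r_def)
    \<comment> \<open>Multiplication by the leading coefficient turns the equation into one for
      \<open>(N + 9) * x\<close>, whose value is given by \<open>y\<close>.\<close>
    have "(N + 9) * ((N + 9) * x\<^sup>2 + 2 * (N + 7) * (N + 5) * x + (N + 6) * (N + 5)\<^sup>2 / 2) =
        ((N + 9) * x)\<^sup>2 + 2 * (N + 7) * (N + 5) * ((N + 9) * x) + (N + 9) * (N + 6) * (N + 5)\<^sup>2 / 2"
      by (simp add: power2_eq_square field_simps)
    also have "\<dots> = (N + 5)\<^sup>2 * (r\<^sup>2 - (N + 7)\<^sup>2 + (N + 9) * (N + 6) / 2)"
      unfolding y by (simp add: power2_eq_square field_simps)
    also have "r\<^sup>2 - (N + 7)\<^sup>2 + (N + 9) * (N + 6) / 2 = 0"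
      unfolding r by (simp add: power2_eq_square field_simps)
    finally have "(N + 9) * ((N + 9) * x\<^sup>2 + 2 * (N + 7) * (N + 5) * x + (N + 6) * (N + 5)\<^sup>2 / 2) = 0"
      by simp
    then show ?thesis using N by simp
  qed
  have x0: "x \<noteq> 0" using x N by auto
  \<comment> \<open>In terms of \<open>n = N + 7\<close>, the support of \<open>a\<close> lies in 1,
    \<open>n - 1\<close>, \<open>n\<close> and that of \<open>b\<close> in 2, 3,
    \<open>n - 2\<close>.\<close>
  define a :: "nat \<Rightarrow> real" where
    "a k = (if k = 1 then - (N + 6) - z else if k = m + 6 then 1 else if k = m + 7 then z else 0)" for k
  define b :: "nat \<Rightarrow> real" where
    "b k = (if k = 2 then x else if k = 3 then s else if k = m + 5 then 1 else 0)" for k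
  \<comment> \<open>Vanishing on the whole plane is shown at once; polarisation then yields the
    orthogonality of \<open>a\<close> and \<open>b\<close>.\<close>
  have psi: "psi n (\<lambda>k. \<alpha> * a k + \<beta> * b k) = 0" for \<alpha> \<beta>
  proof -
    define p where "p k = \<alpha> * a k + \<beta> * b k" for k
    have p: "p 1 = - \<alpha> * (N + 6 + z)" "p 2 = \<beta> * x" "p 3 = \<beta> * s" "p (m + 5) = \<beta>" "p (m + 6) = \<alpha>" "p (m + 7) = \<alpha> * z"
      using m by (simp_all add: p_def a_def b_def algebra_simps)
    have supp: "\<forall>k \<in> {4..m + 4}. p k = 0" by (auto simp: p_def a_def b_def)
    have s': "(N + 5) * (s + 1) = - 2 * x" using N by (simp add: s_def)
    have M: "p 1 + real (m + 6) * p 2 + real (m + 6) * real (m + 5) / 2 * (p 3 + p (m + 5)) + real (m + 6) * p (m + 6) + p (m + 7) = 0"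
    proof -
      have "(N + 6) * (N + 5) / 2 * (\<beta> * s + \<beta>) = (N + 6) / 2 * \<beta> * ((N + 5) * (s + 1))"
        by (simp add: field_simps)
      also have "\<dots> = - ((N + 6) * (\<beta> * x))" unfolding s' by simp
      finally have "(N + 6) * (\<beta> * x) + (N + 6) * (N + 5) / 2 * (\<beta> * s + \<beta>) = 0" by simp
      then show ?thesis unfolding p of_nat_add N_def[symmetric] by (simp add: algebra_simps)
    qed
    have t: "(N + 5) * s = - 2 * x - (N + 5)" using s' by (simp add: algebra_simps)
    \<comment> \<open>The factor \<open>N + 5\<close> clears the denominator of \<open>s\<close>;
      what remains is the quadratic equation for \<open>x\<close>.\<close>
    have "(N + 5) * (x\<^sup>2 + (N + 5) * s\<^sup>2 + (N + 5) * (N + 4) / 2 + 2 * (N + 5) * x)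
        = (N + 5) * x\<^sup>2 + ((N + 5) * s)\<^sup>2 + (N + 5)\<^sup>2 * (N + 4) / 2 + 2 * (N + 5)\<^sup>2 * x"
      by (simp add: power2_eq_square field_simps)
    also have "\<dots> = (N + 9) * x\<^sup>2 + 2 * (N + 7) * (N + 5) * x + (N + 6) * (N + 5)\<^sup>2 / 2"
      unfolding t by (simp add: power2_eq_square field_simps)
    finally have "(N + 5) * (x\<^sup>2 + (N + 5) * s\<^sup>2 + (N + 5) * (N + 4) / 2 + 2 * (N + 5) * x)
        = (N + 9) * x\<^sup>2 + 2 * (N + 7) * (N + 5) * x + (N + 6) * (N + 5)\<^sup>2 / 2" .
    then have Qb: "x\<^sup>2 + (N + 5) * s\<^sup>2 + (N + 5) * (N + 4) / 2 + 2 * (N + 5) * x = 0" using x N by simp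
    have "(p 2)\<^sup>2 + real (m + 5) * (p 3)\<^sup>2 + real (m + 5) * real (m + 4) / 2 * (p (m + 5))\<^sup>2 + real (m + 5) * (p (m + 6))\<^sup>2
       + (p (m + 7))\<^sup>2 + 2 * p 1 * p (m + 6) + 2 * real (m + 5) * p 2 * p (m + 5)
      = \<beta>\<^sup>2 * (x\<^sup>2 + (N + 5) * s\<^sup>2 + (N + 5) * (N + 4) / 2 + 2 * (N + 5) * x) + \<alpha>\<^sup>2 * (z\<^sup>2 - 2 * z - N - 7)"
      unfolding p of_nat_add N_def[symmetric] by (simp add: power2_eq_square field_simps)
    also have "\<dots> = 0" unfolding Qb using z(1) by simp
    finally have "psi n p = 0" unfolding n psi_support_6[OF supp] M by simp
    then show ?thesis unfolding p_def[abs_def] .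
  qed
  show ?thesis
  proof (rule connected_GST_if_isotropic_plane[of n a b])
    show a: "psi n a = 0" and b: "psi n b = 0" using psi[of 1 0] psi[of 0 1] by simp_all
    show "polar n a b = 0" using psi[of 1 1] psi_lincomb[of n 1 a 1 b] a b by simp
    fix \<alpha> \<beta> :: real assume nz: "\<alpha> \<noteq> 0 \<or> \<beta> \<noteq> 0"
    show "\<exists>k \<in> {1..n}. \<alpha> * a k + \<beta> * b k \<noteq> \<alpha> * a (n + 1 - k) + \<beta> * b (n + 1 - k)"
    proof (cases "\<alpha> = 0")
      case True
      \<comment> \<open>The mirror index of 2 is \<open>n - 1\<close>, where \<open>b\<close>
        vanishes, whereas \<open>b 2 = x\<close> is nonzero.\<close>
      then show ?thesis
        using nz x0 m by (intro bexI[of _ 2]) (auto simp: n a_def b_def)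
    next
      case False
      \<comment> \<open>The mirror index of 1 is \<open>n\<close>. There \<open>b\<close> vanishes
        at both ends, while \<open>a\<close> is negative at 1 and positive at
        \<open>n\<close>.\<close>
      have "- (N + 6) - z \<noteq> z" using z(2) N by linarith
      with False show ?thesis
        using m by (intro bexI[of _ 1]) (auto simp: n a_def b_def)
    qed
  qed (use assms in simp)
qed

theorem theorem7p3:
  fixes n :: nat
  assumes "n \<ge> 3"
  shows "(n \<ge> 8 \<and> num_pos_eigenvalues (Hess n) \<ge> 2 \<and> num_neg_eigenvalues (Hess n) \<ge> 2
            \<longrightarrow> connected_space (GST_space n)) \<and>
         (num_pos_eigenvalues (Hess n) = 1 \<or> num_neg_eigenvalues (Hess n) = 1
            \<longrightarrow> \<not> connected_space (GST_space n))"
proof (intro conjI impI)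
  assume "n \<ge> 8 \<and> num_pos_eigenvalues (Hess n) \<ge> 2 \<and> num_neg_eigenvalues (Hess n) \<ge> 2"
  then show "connected_space (GST_space n)" by (intro connected_GST) simp
next
  assume one: "num_pos_eigenvalues (Hess n) = 1 \<or> num_neg_eigenvalues (Hess n) = 1"
  have "n < 5"
  proof (rule ccontr)
    assume "\<not> n < 5"
    then have "n \<ge> 5" by simp
    from num_pos_eigenvalues_Hess_ge_2[OF this] num_neg_eigenvalues_Hess_ge_2[OF this] one
    show False by auto
  qed
  with assms have "n = 3 \<or> n = 4" by linarith
  then show "\<not> connected_space (GST_space n)"
    using not_connected_GST_3 not_connected_GST_4 by blast
qed

end
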